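(* Let $G$ be an amenable branch group. Then each of $\mathcal{A}_{sn}(G)$, $\mathcal{J}_{sn}(G)$ and $\operatorname{rad}\ell^1(G)^{**}$ contains nilpotent elements of arbitrarily large index.
   Context: All groups are discrete. For a group $G$, $\ell^1(G)$ is the Banach algebra of absolutely summable functions $G\to\mathbb{C}$ under convolution; $\delta_t$ is the point mass at $t$; $\ell^1(G)^*=\ell^\infty(G)$, and $1$ is the constant function. The bidual $\ell^1(G)^{**}$ carries the first Arens product $\Box$: for a Banach algebra $A$, $\langle \Psi\Box\Phi,\lambda\rangle=\langle\Psi,\Phi\cdot\lambda\rangle$, $\langle a,\Phi\cdot\lambda\rangle=\langle\Phi,\lambda\cdot a\rangle$, $\langle b,\lambda\cdot a\rangle=\langle ab,\lambda\rangle$ ($\Phi,\Psi\in A^{**}$, $\lambda\in A^*$, $a,b\in A$). For $H\le G$, $\ell^1(H)^{**}$ is identified with its image in $\ell^1(G)^{**}$ under the second adjoint of the inclusion $\ell^1(H)\hookrightarrow\ell^1(G)$. An invariant difference on a group $H$ is an element $\Gamma\in\ell^1(H)^{**}$ with $\delta_s\Box\Gamma=\Gamma$ for all $s\in H$ and $\langle\Gamma,1\rangle=0$. $\mathcal{D}(H)$ is the set of invariant differences on $H$. A subgroup $H\le G$ is subnormal if there is a finite chain $H=H_n\lhd H_{n-1}\lhd\cdots\lhd H_1\lhd G$. Define $$\mathcal{A}_{sn}(G)=\operatorname{span}\{\Gamma_1\Box\cdots\Box\Gamma_n : n\in\mathbb{N},\ \Gamma_i\in\mathcal{D}(H_i)\text{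 for some subnormal subgroups } H_i\text{ of }G\},$$ $$\mathcal{J}_{sn}(G)=\operatorname{span}\{\Phi\Box\Gamma:\Phi\in\ell^1(G)^{**},\ \Gamma\in\mathcal{D}(H)\text{ for some subnormal subgroup } H\text{ of } G\}.$$ The index of a nilpotent element $\Phi$ is the least $n\in\mathbb{N}$ with $\Phi^{\Box n}=0$. The Jacobson radical $\operatorname{rad}A$ of a unital algebra $A$ is the intersection of its maximal left ideals; here it is taken for $(\ell^1(G)^{**},\Box)$. An infinite group $G$ is a branch group if there exist descending chains of subgroups $H_1\supset H_2\supset\cdots$ and $L_1\supset L_2\supset\cdots$ and natural numbers $(k_i)_{i\in\mathbb{N}}$ such that: (1) $\bigcap_i H_i=1$; (2) each $H_i$ is a finite-index normal subgroup of $G$; (3) each $H_i$ is an (internal) direct product $L_i^{(1)}\times\cdots\times L_i^{(k_i)}$ with each factor isomorphic to $L_i$; (4) for each $i$, $m_i:=k_{i+1}/k_i$ is an integer at least $2$, and the decomposition of $H_{i+1}$ properly refines that of $H_i$ in the sense that each $L_i^{(j)}$ contains the subgroups $L_{i+1}^{(l)}$ for $l=(j-1)m_i+1,\dots,jm_i$; (5) conjugation by $G$ transitively permutes the subgroups $L_i^{(1)},\dots,L_i^{(k_i)}$. *)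

theory Defs
  imports
    "HOL-Analysis.Analysis"
    "HOL-Library.Function_Algebras"
    "HOL-Algebra.AbelCoset"
    "HOL-Algebra.Generated_Groups"
begin

section \<open>Normed spaces of functions and their duals\<close>

text \<open>
  All spaces in this development are complex vector spaces of functions \<open>'i \<Rightarrow> complex\<close> with
  pointwise operations, given by a carrier \<open>X\<close> and a norm \<open>N\<close>. A functional on \<open>X\<close> is
  represented by a function on the whole type that vanishes outside \<open>X\<close>, so the dual of such a
  space is again a space of functions, and the construction can be iterated.
\<close>

definition dual ::
  "('i \<Rightarrow> complex) set \<Rightarrow> (('i \<Rightarrow> complex) \<Rightarrow> real) \<Rightarrow> (('i \<Rightarrow> complex) \<Rightarrow> complex) set"
  where
  "dual X N = {\<phi>. (\<forall>x. x \<notin> X \<longrightarrow> \<phi> x = 0)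
      \<and> (\<forall>x\<in>X. \<forall>y\<in>X. \<phi> (\<lambda>i. x i + y i) = \<phi> x + \<phi> y)
      \<and> (\<forall>c. \<forall>x\<in>X. \<phi> (\<lambda>i. c * x i) = c * \<phi> x)
      \<and> (\<exists>B. \<forall>x\<in>X. cmod (\<phi> x) \<le> B * N x)}"

definition dual_norm ::
  "('i \<Rightarrow> complex) set \<Rightarrow> (('i \<Rightarrow> complex) \<Rightarrow> real) \<Rightarrow> (('i \<Rightarrow> complex) \<Rightarrow> complex) \<Rightarrow> real"
  where "dual_norm X N \<phi> = (SUP x\<in>{x \<in> X. N x \<le> 1}. cmod (\<phi> x))"

definition bidual ::
  "('i \<Rightarrow> complex) set \<Rightarrow> (('i \<Rightarrow> complex) \<Rightarrow> real) \<Rightarrow> ((('i \<Rightarrow> complex) \<Rightarrow> complex) \<Rightarrow> complex) set"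
  where "bidual X N = dual (dual X N) (dual_norm X N)"

definition bidual_norm ::
  "('i \<Rightarrow> complex) set \<Rightarrow> (('i \<Rightarrow> complex) \<Rightarrow> real) \<Rightarrow> ((('i \<Rightarrow> complex) \<Rightarrow> complex) \<Rightarrow> complex) \<Rightarrow> real"
  where "bidual_norm X N = dual_norm (dual X N) (dual_norm X N)"

definition bidual_embed ::
  "('i \<Rightarrow> complex) set \<Rightarrow> (('i \<Rightarrow> complex) \<Rightarrow> real) \<Rightarrow> ('i \<Rightarrow> complex)
    \<Rightarrow> (('i \<Rightarrow> complex) \<Rightarrow> complex) \<Rightarrow> complex"
  where "bidual_embed X N a = (\<lambda>\<phi>. if \<phi> \<in> dual X N then \<phi> a else 0)"

text \<open>The adjoint of a map \<open>T\<close> with domain \<open>X\<close>, sending functionals on the codomain to functionals on \<open>X\<close>.\<close>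

definition adjoint_map :: "'x set \<Rightarrow> ('x \<Rightarrow> 'y) \<Rightarrow> ('y \<Rightarrow> complex) \<Rightarrow> 'x \<Rightarrow> complex"
  where "adjoint_map X T \<phi> = (\<lambda>x. if x \<in> X then \<phi> (T x) else 0)"


section \<open>The first Arens product\<close>

text \<open>\<open>X\<close>, \<open>N\<close> and \<open>m\<close> are the carrier, norm and product of a Banach algebra.\<close>

definition dual_right_act ::
  "('i \<Rightarrow> complex) set \<Rightarrow> (('i \<Rightarrow> complex) \<Rightarrow> ('i \<Rightarrow> complex) \<Rightarrow> ('i \<Rightarrow> complex))
    \<Rightarrow> (('i \<Rightarrow> complex) \<Rightarrow> complex) \<Rightarrow> ('i \<Rightarrow> complex) \<Rightarrow> (('i \<Rightarrow> complex) \<Rightarrow> complex)"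
  where "dual_right_act X m u a = (\<lambda>b. if b \<in> X then u (m a b) else 0)"

definition bidual_left_act ::
  "('i \<Rightarrow> complex) set \<Rightarrow> (('i \<Rightarrow> complex) \<Rightarrow> ('i \<Rightarrow> complex) \<Rightarrow> ('i \<Rightarrow> complex))
    \<Rightarrow> ((('i \<Rightarrow> complex) \<Rightarrow> complex) \<Rightarrow> complex) \<Rightarrow> (('i \<Rightarrow> complex) \<Rightarrow> complex)
    \<Rightarrow> (('i \<Rightarrow> complex) \<Rightarrow> complex)"
  where "bidual_left_act X m \<Phi> u = (\<lambda>a. if a \<in> X then \<Phi> (dual_right_act X m u a) else 0)"

definition arens_product ::
  "('i \<Rightarrow> complex) set \<Rightarrow> (('i \<Rightarrow> complex) \<Rightarrow> real)
    \<Rightarrow> (('i \<Rightarrow> complex) \<Rightarrow> ('i \<Rightarrow> complex) \<Rightarrow> ('i \<Rightarrow> complex))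
    \<Rightarrow> ((('i \<Rightarrow> complex) \<Rightarrow> complex) \<Rightarrow> complex) \<Rightarrow> ((('i \<Rightarrow> complex) \<Rightarrow> complex) \<Rightarrow> complex)
    \<Rightarrow> ((('i \<Rightarrow> complex) \<Rightarrow> complex) \<Rightarrow> complex)"
  where
  "arens_product X N m \<Psi> \<Phi> = (\<lambda>u. if u \<in> dual X N then \<Psi> (bidual_left_act X m \<Phi> u) else 0)"


section \<open>The group algebra and its bidual\<close>

text \<open>
  Elements of the group algebra vanish outside the carrier. Consequently, for a subgroup \<open>H\<close> of
  \<open>G\<close>, \<open>ell1 (G\<lparr>carrier := H\<rparr>)\<close> is literally a subset of \<open>ell1 G\<close>, and the inclusion is the
  identity map.
\<close>

definition ell1 :: "('a, 'b) monoid_scheme \<Rightarrow> ('a \<Rightarrow> complex) set"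
  where "ell1 G = {f. (\<forall>x. x \<notin> carrier G \<longrightarrow> f x = 0) \<and> (\<lambda>x. cmod (f x)) summable_on carrier G}"

definition ell1_norm :: "('a, 'b) monoid_scheme \<Rightarrow> ('a \<Rightarrow> complex) \<Rightarrow> real"
  where "ell1_norm G f = (\<Sum>\<^sub>\<infinity>x\<in>carrier G. cmod (f x))"

definition convolution ::
  "('a, 'b) monoid_scheme \<Rightarrow> ('a \<Rightarrow> complex) \<Rightarrow> ('a \<Rightarrow> complex) \<Rightarrow> 'a \<Rightarrow> complex"
  where
  "convolution G f g = (\<lambda>x. if x \<in> carrier G
      then (\<Sum>\<^sub>\<infinity>t\<in>carrier G. f t * g (inv\<^bsub>G\<^esub> t \<otimes>\<^bsub>G\<^esub> x)) else 0)"

definition point_mass :: "'a \<Rightarrow> 'a \<Rightarrow> complex"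
  where "point_mass t = (\<lambda>x. if x = t then 1 else 0)"

text \<open>The identification of bounded functions on \<open>G\<close> with functionals on \<open>ell1 G\<close>.\<close>

definition linf_functional ::
  "('a, 'b) monoid_scheme \<Rightarrow> ('a \<Rightarrow> complex) \<Rightarrow> ('a \<Rightarrow> complex) \<Rightarrow> complex"
  where "linf_functional G u = (\<lambda>f. if f \<in> ell1 G then (\<Sum>\<^sub>\<infinity>x\<in>carrier G. f x * u x) else 0)"

type_synonym 'a bidual_elem = "(('a \<Rightarrow> complex) \<Rightarrow> complex) \<Rightarrow> complex"

abbreviation ell1_bidual :: "('a, 'b) monoid_scheme \<Rightarrow> 'a bidual_elem set"
  where "ell1_bidual G \<equiv> bidual (ell1 G) (ell1_norm G)"

definition delta :: "('a, 'b) monoid_scheme \<Rightarrow> 'a \<Rightarrow> 'a bidual_elem"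
  where "delta G t = bidual_embed (ell1 G) (ell1_norm G) (point_mass t)"

definition arens ::
  "('a, 'b) monoid_scheme \<Rightarrow> 'a bidual_elem \<Rightarrow> 'a bidual_elem \<Rightarrow> 'a bidual_elem"
  where "arens G = arens_product (ell1 G) (ell1_norm G) (convolution G)"

definition bidual_ring :: "('a, 'b) monoid_scheme \<Rightarrow> 'a bidual_elem ring"
  where
  "bidual_ring G = \<lparr>carrier = ell1_bidual G, mult = arens G, one = delta G \<one>\<^bsub>G\<^esub>,
     zero = (\<lambda>_. 0), add = (\<lambda>\<Phi> \<Psi> \<phi>. \<Phi> \<phi> + \<Psi> \<phi>)\<rparr>"

definition bidual_span :: "'a bidual_elem set \<Rightarrow> 'a bidual_elem set"
  where "bidual_span = module.span (\<lambda>(c :: complex) \<Phi> \<phi>. c * \<Phi> \<phi>)"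

definition bidual_incl :: "('a, 'b) monoid_scheme \<Rightarrow> 'a set \<Rightarrow> 'a bidual_elem \<Rightarrow> 'a bidual_elem"
  where
  "bidual_incl G H =
     adjoint_map (dual (ell1 G) (ell1_norm G)) (adjoint_map (ell1 (G\<lparr>carrier := H\<rparr>)) (\<lambda>f. f))"


section \<open>Invariant differences and amenability\<close>

definition invariant_differences :: "('a, 'b) monoid_scheme \<Rightarrow> 'a bidual_elem set"
  where
  "invariant_differences H = {\<Gamma> \<in> ell1_bidual H.
     (\<forall>s\<in>carrier H. arens H (delta H s) \<Gamma> = \<Gamma>) \<and> \<Gamma> (linf_functional H (\<lambda>_. 1)) = 0}"

definition amenable :: "('a, 'b) monoid_scheme \<Rightarrow> bool"
  where
  "amenable G \<longleftrightarrow> (\<exists>M \<in> ell1_bidual G.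
     bidual_norm (ell1 G) (ell1_norm G) M = 1 \<and> M (linf_functional G (\<lambda>_. 1)) = 1
     \<and> (\<forall>s\<in>carrier G. arens G (delta G s) M = M))"

definition subnormal :: "'a set \<Rightarrow> ('a, 'b) monoid_scheme \<Rightarrow> bool"
  where
  "subnormal H G \<longleftrightarrow> (\<exists>(n::nat) S. S 0 = carrier G \<and> S n = H
     \<and> (\<forall>i<n. S (Suc i) \<lhd> (G\<lparr>carrier := S i\<rparr>)))"

definition sn_differences :: "('a, 'b) monoid_scheme \<Rightarrow> 'a bidual_elem set"
  where
  "sn_differences G =
     (\<Union>H\<in>{H. subnormal H G}. bidual_incl G H ` invariant_differences (G\<lparr>carrier := H\<rparr>))"

text \<open>The products below have at least one factor.\<close>

definition A_sn :: "('a, 'b) monoid_scheme \<Rightarrow> 'a bidual_elem set"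
  where
  "A_sn G = bidual_span {foldr (arens G) (butlast \<Gamma>s) (last \<Gamma>s) |\<Gamma>s.
     \<Gamma>s \<noteq> [] \<and> set \<Gamma>s \<subseteq> sn_differences G}"

definition J_sn :: "('a, 'b) monoid_scheme \<Rightarrow> 'a bidual_elem set"
  where
  "J_sn G = bidual_span {arens G \<Phi> \<Gamma> |\<Phi> \<Gamma>. \<Phi> \<in> ell1_bidual G \<and> \<Gamma> \<in> sn_differences G}"


section \<open>Nilpotency and the Jacobson radical\<close>

definition nilpotent_elem :: "('a, 'b) ring_scheme \<Rightarrow> 'a \<Rightarrow> bool"
  where "nilpotent_elem R x \<longleftrightarrow> x \<in> carrier R \<and> (\<exists>n::nat. n > 0 \<and> x [^]\<^bsub>R\<^esub> n = \<zero>\<^bsub>R\<^esub>)"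

definition nilpotency_index :: "('a, 'b) ring_scheme \<Rightarrow> 'a \<Rightarrow> nat"
  where "nilpotency_index R x = (LEAST n. n > 0 \<and> x [^]\<^bsub>R\<^esub> n = \<zero>\<^bsub>R\<^esub>)"

text \<open>
  For a unital algebra, ring left ideals are closed under scalars, since \<open>c x = (c 1) x\<close>; so they
  are the same as the algebra left ideals.
\<close>

definition left_ideal :: "'a set \<Rightarrow> ('a, 'b) ring_scheme \<Rightarrow> bool"
  where "left_ideal I R \<longleftrightarrow> additive_subgroup I R \<and> (\<forall>a\<in>carrier R. \<forall>x\<in>I. a \<otimes>\<^bsub>R\<^esub> x \<in> I)"

definition maximal_left_ideal :: "'a set \<Rightarrow> ('a, 'b) ring_scheme \<Rightarrow> bool"
  where
  "maximal_left_ideal I R \<longleftrightarrow> left_ideal I R \<and> I \<noteq> carrier R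
     \<and> (\<forall>J. left_ideal J R \<and> I \<subseteq> J \<longrightarrow> J = I \<or> J = carrier R)"

definition jacobson_radical :: "('a, 'b) ring_scheme \<Rightarrow> 'a set"
  where "jacobson_radical R = {x \<in> carrier R. \<forall>I. maximal_left_ideal I R \<longrightarrow> x \<in> I}"


section \<open>Branch groups\<close>

definition internal_direct_product ::
  "('a, 'b) monoid_scheme \<Rightarrow> 'a set \<Rightarrow> nat \<Rightarrow> (nat \<Rightarrow> 'a set) \<Rightarrow> bool"
  where
  "internal_direct_product G H k L \<longleftrightarrow>
     (\<forall>j<k. L j \<lhd> (G\<lparr>carrier := H\<rparr>))
     \<and> generate G (\<Union>j<k. L j) = H
     \<and> (\<forall>j<k. L j \<inter> generate G (\<Union>l\<in>{..<k} - {j}. L l) = {\<one>\<^bsub>G\<^esub>})"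

text \<open>
  Levels \<open>i\<close> and factors \<open>j\<close> are numbered from \<open>0\<close>: the factor \<open>F i j\<close> contains the factors
  \<open>F (i + 1) l\<close> for \<open>l = j m, \<dots>, j m + m - 1\<close>, where \<open>m = k (i + 1) / k i\<close>.
\<close>

definition branch_group :: "('a, 'b) monoid_scheme \<Rightarrow> bool"
  where
  "branch_group G \<longleftrightarrow> group G \<and> infinite (carrier G) \<and>
     (\<exists>(H :: nat \<Rightarrow> 'a set) (L :: nat \<Rightarrow> 'a set) (F :: nat \<Rightarrow> nat \<Rightarrow> 'a set) (k :: nat \<Rightarrow> nat).
        (\<forall>i. subgroup (H i) G \<and> H (Suc i) \<subseteq> H i)
      \<and> (\<forall>i. subgroup (L i) G \<and> L (Suc i) \<subseteq> L i)
      \<and> (\<forall>i. 0 < k i)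
      \<and> (\<Inter>i. H i) = {\<one>\<^bsub>G\<^esub>}
      \<and> (\<forall>i. H i \<lhd> G \<and> finite (rcosets\<^bsub>G\<^esub> (H i)))
      \<and> (\<forall>i. internal_direct_product G (H i) (k i) (F i)
             \<and> (\<forall>j<k i. (G\<lparr>carrier := F i j\<rparr>) \<cong> (G\<lparr>carrier := L i\<rparr>)))
      \<and> (\<forall>i. k i dvd k (Suc i) \<and> 2 \<le> k (Suc i) div k i
             \<and> (let m = k (Suc i) div k i in
                  \<forall>j<k i. \<forall>l\<in>{j * m..<(j + 1) * m}. F (Suc i) l \<subseteq> F i j))
      \<and> (\<forall>i. (\<forall>g\<in>carrier G. \<forall>j<k i. \<exists>l<k i.
                 (\<lambda>h. g \<otimes>\<^bsub>G\<^esub> h \<otimes>\<^bsub>G\<^esub> inv\<^bsub>G\<^esub> g) ` F i j = F i l)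
             \<and> (\<forall>j<k i. \<forall>l<k i. \<exists>g\<in>carrier G.
                 (\<lambda>h. g \<otimes>\<^bsub>G\<^esub> h \<otimes>\<^bsub>G\<^esub> inv\<^bsub>G\<^esub> g) ` F i j = F i l)))"

end

theory Submission
  imports Defs "HOL-Algebra.Zassenhaus"
begin

text \<open>
  A bidual element \<open>\<Phi>\<close> acts on bounded functions by \<open>(\<Phi> f)(s) = \<Phi>(t \<mapsto> f(s t))\<close>, and the Arens
  product becomes composition of these operators. Take a level \<open>F\<^sub>1 \<times> \<dots> \<times> F\<^sub>k\<close> of the branch
  structure, a nonzero invariant difference \<open>\<Gamma>\<^sub>j\<close> on each \<open>F\<^sub>j\<close>, and \<open>\<Phi> = \<Gamma>\<^sub>1 + \<dots> + \<Gamma>\<^sub>k\<close>. Let \<open>V\<^sub>m\<close>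
  be the span of the bounded functions that are right invariant under at least \<open>m\<close> of the factors.
  Conjugation permutes the factors, so every bidual element preserves \<open>V\<^sub>m\<close>, while \<open>\<Gamma>\<^sub>j\<close> kills
  \<open>F\<^sub>j\<close>-invariant functions and makes the others \<open>F\<^sub>j\<close>-invariant, so that \<open>\<Phi>\<close> maps \<open>V\<^sub>m\<close> into \<open>V\<^sub>m\<^sub>+\<^sub>1\<close>.
  As \<open>V\<^sub>k\<^sub>+\<^sub>1 = 0\<close>, the left ideal generated by \<open>\<Phi>\<close> is nil, and \<open>\<Phi>\<close> lies in the radical. On a
  product \<open>a\<^sub>1 \<otimes> \<dots> \<otimes> a\<^sub>k\<close> with \<open>\<Gamma>\<^sub>j(a\<^sub>j) = 1\<close> the power \<open>\<Phi>\<^sup>k\<close> takes the value \<open>k!\<close>, so the index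
  of \<open>\<Phi>\<close> exceeds \<open>k\<close>.
\<close>

section \<open>Bounded functionals on bounded functions\<close>

text \<open>The filtration is shaped by the need to survive multiplication on the left by an
  arbitrary element. If f is right invariant under K, then s |-> f(s t) is right invariant under t K
  t^-1, so averaging over t can destroy invariance under every single factor. As the conjugates of
  the factors form a finite set, the average splits into finitely many pieces, each invariant under
  as many factors as f was; hence a span over all families of m factors instead of one fixed family.

  A nonzero invariant difference needs two invariant functionals that agree at 1 and are distinct.
  Amenability of G gives one mean, carried to a subgroup along a map that commutes with left
  translations; right translation by a sequence in the infinite subgroup gives the second.

  The factorial counts orderings: on a product of functions each \<open>\<Gamma>\<close> can act
  once, after which its factor has become a constant, so k applications of the sum reach the empty
  product along all k! orders. As the power k + 1 is killed, the index is exactly k + 1, and it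
  remains to choose a level with many factors.\<close>

definition bounded_fun :: "'a set \<Rightarrow> ('a \<Rightarrow> complex) \<Rightarrow> bool"
  where "bounded_fun S f \<longleftrightarrow> (\<exists>K. \<forall>x\<in>S. cmod (f x) \<le> K)"

text \<open>An element of the dual of the bounded functions on S, with arbitrary upper bounds K in
  place of the supremum norm. It takes functions on the whole type and looks only at their values on
  S, so a functional on a subgroup is already one on the group (\<open>functional_on_mono\<close>)
  and no restriction maps appear. At functions unbounded on S only this dependence on S is
  prescribed.\<close>

definition functional_on :: "'a set \<Rightarrow> (('a \<Rightarrow> complex) \<Rightarrow> complex) \<Rightarrow> bool"
  where "functional_on S \<phi> \<longleftrightarrow>
     (\<forall>f g. (\<forall>x\<in>S. f x = g x) \<longrightarrow> \<phi> f = \<phi> g)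
   \<and> (\<forall>f g. bounded_fun S f \<longrightarrow> bounded_fun S g \<longrightarrow> \<phi> (\<lambda>x. f x + g x) = \<phi> f + \<phi> g)
   \<and> (\<forall>c f. bounded_fun S f \<longrightarrow> \<phi> (\<lambda>x. c * f x) = c * \<phi> f)
   \<and> (\<exists>C\<ge>0. \<forall>f K. 0 \<le> K \<longrightarrow> (\<forall>x\<in>S. cmod (f x) \<le> K) \<longrightarrow> cmod (\<phi> f) \<le> C * K)"

lemma bounded_funI: "(\<And>x. x \<in> S \<Longrightarrow> cmod (f x) \<le> K) \<Longrightarrow> bounded_fun S f"
  unfolding bounded_fun_def by blast

lemma bounded_funD:
  assumes "bounded_fun S f"
  shows "\<exists>K\<ge>0. \<forall>x\<in>S. cmod (f x) \<le> K"
proof -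
  obtain K where K: "\<forall>x\<in>S. cmod (f x) \<le> K"
    using assms unfolding bounded_fun_def by blast
  have "\<forall>x\<in>S. cmod (f x) \<le> max K 0"
    using K by (auto simp: le_max_iff_disj)
  then show ?thesis
    by (intro exI[of _ "max K 0"]) simp
qed

lemma bounded_fun_const [simp]: "bounded_fun S (\<lambda>_. c)"
  by (rule bounded_funI[of _ _ "cmod c"]) simp

lemma bounded_fun_add:
  assumes "bounded_fun S f" "bounded_fun S g"
  shows "bounded_fun S (\<lambda>x. f x + g x)"
proof -
  obtain K where K: "0 \<le> K" "\<And>x. x \<in> S \<Longrightarrow> cmod (f x) \<le> K"
    using bounded_funD[OF assms(1)] by blast
  obtain L where L: "0 \<le> L" "\<And>x. x \<in> S \<Longrightarrow> cmod (g x) \<le> L"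
    using bounded_funD[OF assms(2)] by blast
  show ?thesis
    by (intro bounded_funI[of _ _ "K + L"] norm_triangle_mono K L)
qed

lemma bounded_fun_mult:
  assumes "bounded_fun S f" "bounded_fun S g"
  shows "bounded_fun S (\<lambda>x. f x * g x)"
proof -
  obtain K where K: "0 \<le> K" "\<And>x. x \<in> S \<Longrightarrow> cmod (f x) \<le> K"
    using bounded_funD[OF assms(1)] by blast
  obtain L where L: "0 \<le> L" "\<And>x. x \<in> S \<Longrightarrow> cmod (g x) \<le> L"
    using bounded_funD[OF assms(2)] by blast
  show ?thesis
    by (intro bounded_funI[of _ _ "K * L"]) (simp only: norm_mult, intro mult_mono K L norm_ge_zero)
qed

lemma bounded_fun_sum:
  assumes "\<And>i. i \<in> I \<Longrightarrow> bounded_fun S (f i)"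
  shows "bounded_fun S (\<lambda>x. \<Sum>i\<in>I. f i x)"
  using assms by (induction I rule: infinite_finite_induct) (auto intro: bounded_fun_add)

lemma bounded_fun_if:
  assumes "bounded_fun S f"
  shows "bounded_fun S (\<lambda>x. if P x then f x else 0)"
proof -
  obtain K where "0 \<le> K" "\<forall>x\<in>S. cmod (f x) \<le> K"
    using bounded_funD[OF assms] by blast
  then show ?thesis
    by (intro bounded_funI[of _ _ K]) simp
qed

lemma bounded_fun_indicator: "bounded_fun S (\<lambda>x. if P x then 1 else 0)"
  by (rule bounded_fun_if) (rule bounded_fun_const)

lemma bounded_fun_compose:
  "bounded_fun T f \<Longrightarrow> (\<And>x. x \<in> S \<Longrightarrow> h x \<in> T) \<Longrightarrow> bounded_fun S (\<lambda>x. f (h x))"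
  unfolding bounded_fun_def by blast

lemma functional_onI:
  assumes "\<And>f g. (\<And>x. x \<in> S \<Longrightarrow> f x = g x) \<Longrightarrow> \<phi> f = \<phi> g"
    and "\<And>f g. bounded_fun S f \<Longrightarrow> bounded_fun S g \<Longrightarrow> \<phi> (\<lambda>x. f x + g x) = \<phi> f + \<phi> g"
    and "\<And>c f. bounded_fun S f \<Longrightarrow> \<phi> (\<lambda>x. c * f x) = c * \<phi> f"
    and "0 \<le> C"
    and "\<And>f K. 0 \<le> K \<Longrightarrow> (\<And>x. x \<in> S \<Longrightarrow> cmod (f x) \<le> K) \<Longrightarrow> cmod (\<phi> f) \<le> C * K"
  shows "functional_on S \<phi>"
  unfolding functional_on_def
proof (intro conjI allI impI exI[of _ C])
  show "\<phi> f = \<phi> g" if "\<forall>x\<in>S. f x = g x" for f g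
    using that by (intro assms(1)) simp
  show "cmod (\<phi> f) \<le> C * K" if "0 \<le> K" "\<forall>x\<in>S. cmod (f x) \<le> K" for f K
    using that by (intro assms(5)) simp_all
qed (fact assms(2-4))+

lemma functional_on_cong:
  "functional_on S \<phi> \<Longrightarrow> (\<And>x. x \<in> S \<Longrightarrow> f x = g x) \<Longrightarrow> \<phi> f = \<phi> g"
  unfolding functional_on_def by blast

lemma functional_on_add:
  "functional_on S \<phi> \<Longrightarrow> bounded_fun S f \<Longrightarrow> bounded_fun S g \<Longrightarrow> \<phi> (\<lambda>x. f x + g x) = \<phi> f + \<phi> g"
  unfolding functional_on_def by blast

lemma functional_on_scale:
  "functional_on S \<phi> \<Longrightarrow> bounded_fun S f \<Longrightarrow> \<phi> (\<lambda>x. c * f x) = c * \<phi> f"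
  unfolding functional_on_def by blast

lemma functional_on_bound:
  "functional_on S \<phi> \<Longrightarrow>
    \<exists>C\<ge>0. \<forall>f K. 0 \<le> K \<longrightarrow> (\<forall>x\<in>S. cmod (f x) \<le> K) \<longrightarrow> cmod (\<phi> f) \<le> C * K"
  unfolding functional_on_def by (elim conjE)

lemma functional_on_zero: "functional_on S \<phi> \<Longrightarrow> \<phi> (\<lambda>_. 0) = 0"
  using functional_on_scale[of S \<phi> "\<lambda>_. 0" 0] by simp

lemma functional_on_const: "functional_on S \<phi> \<Longrightarrow> \<phi> (\<lambda>_. c) = c * \<phi> (\<lambda>_. 1)"
  using functional_on_scale[of S \<phi> "\<lambda>_. 1" c] by simp

lemma functional_on_sum:
  assumes "functional_on S \<phi>" "\<And>i. i \<in> I \<Longrightarrow> bounded_fun S (f i)"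
  shows "\<phi> (\<lambda>x. \<Sum>i\<in>I. f i x) = (\<Sum>i\<in>I. \<phi> (f i))"
  using assms(2)
  by (induction I rule: infinite_finite_induct)
     (auto simp: functional_on_zero[OF assms(1)] functional_on_add[OF assms(1)] bounded_fun_sum)

lemma functional_on_mono:
  assumes \<phi>: "functional_on S \<phi>" and "S \<subseteq> T"
  shows "functional_on T \<phi>"
proof -
  have bf: "bounded_fun T f \<Longrightarrow> bounded_fun S f" for f
    using assms(2) unfolding bounded_fun_def by blast
  obtain C where C: "0 \<le> C"
    "\<forall>f K. 0 \<le> K \<longrightarrow> (\<forall>x\<in>S. cmod (f x) \<le> K) \<longrightarrow> cmod (\<phi> f) \<le> C * K"
    using functional_on_bound[OF \<phi>] by blast
  note C = C(1) C(2)[rule_format]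
  show ?thesis
  proof (rule functional_onI[OF _ _ _ C(1)])
    show "\<phi> f = \<phi> g" if "\<And>x. x \<in> T \<Longrightarrow> f x = g x" for f g
      using that assms(2) by (intro functional_on_cong[OF \<phi>]) blast
    show "cmod (\<phi> f) \<le> C * K" if "0 \<le> K" "\<And>x. x \<in> T \<Longrightarrow> cmod (f x) \<le> K" for f K
      using that assms(2) by (intro C(2)) blast+
  qed (simp_all add: bf functional_on_add[OF \<phi>] functional_on_scale[OF \<phi>])
qed

lemma functional_on_diff:
  assumes \<phi>: "functional_on S \<phi>" and \<psi>: "functional_on S \<psi>"
  shows "functional_on S (\<lambda>f. \<phi> f - \<psi> f)"
proof -
  obtain C where C: "0 \<le> C"
    "\<forall>f K. 0 \<le> K \<longrightarrow> (\<forall>x\<in>S. cmod (f x) \<le> K) \<longrightarrow> cmod (\<phi> f) \<le> C * K"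
    using functional_on_bound[OF \<phi>] by blast
  note C = C(1) C(2)[rule_format]
  obtain D where D: "0 \<le> D"
    "\<forall>f K. 0 \<le> K \<longrightarrow> (\<forall>x\<in>S. cmod (f x) \<le> K) \<longrightarrow> cmod (\<psi> f) \<le> D * K"
    using functional_on_bound[OF \<psi>] by blast
  note D = D(1) D(2)[rule_format]
  show ?thesis
  proof (rule functional_onI)
    show "\<phi> f - \<psi> f = \<phi> g - \<psi> g" if "\<And>x. x \<in> S \<Longrightarrow> f x = g x" for f g
      using functional_on_cong[OF \<phi>, of f g] functional_on_cong[OF \<psi>, of f g] that by simp
    show "cmod (\<phi> f - \<psi> f) \<le> (C + D) * K" if "0 \<le> K" "\<And>x. x \<in> S \<Longrightarrow> cmod (f x) \<le> K" for f K
      using norm_triangle_ineq4[of "\<phi> f" "\<psi> f"] C(2)[of K f, OF that] D(2)[of K f, OF that]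
      by (simp add: distrib_right)
  qed (simp_all add: C(1) D(1) functional_on_add[OF \<phi>] functional_on_add[OF \<psi>]
          functional_on_scale[OF \<phi>] functional_on_scale[OF \<psi>] right_diff_distrib)
qed

lemma bounded_fun_apply:
  assumes \<phi>: "functional_on S \<phi>" and "bounded_fun U f" "\<And>s t. s \<in> X \<Longrightarrow> t \<in> S \<Longrightarrow> m s t \<in> U"
  shows "bounded_fun X (\<lambda>s. \<phi> (\<lambda>t. f (m s t)))"
proof -
  obtain C where C: "0 \<le> C"
    "\<forall>f K. 0 \<le> K \<longrightarrow> (\<forall>x\<in>S. cmod (f x) \<le> K) \<longrightarrow> cmod (\<phi> f) \<le> C * K"
    using functional_on_bound[OF \<phi>] by blast
  note C = C(1) C(2)[rule_format]
  obtain K where "0 \<le> K" "\<And>x. x \<in> U \<Longrightarrow> cmod (f x) \<le> K"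
    using bounded_funD[OF assms(2)] by blast
  then show ?thesis
    using assms(3) by (intro bounded_funI[of _ _ "C * K"] C(2)) auto
qed

text \<open>The map \<open>m\<close> is left general for two instances: group multiplication, which
  gives the Arens product, and a map built from a retraction and a sequence, which gives invariant
  differences. The constants of the two functionals multiply.\<close>

lemma functional_on_iterate:
  assumes \<psi>: "functional_on T \<psi>" and \<phi>: "functional_on S \<phi>"
    and m: "\<And>s t. s \<in> T \<Longrightarrow> t \<in> S \<Longrightarrow> m s t \<in> U"
  shows "functional_on U (\<lambda>f. \<psi> (\<lambda>s. \<phi> (\<lambda>t. f (m s t))))"
proof -
  obtain C where C: "0 \<le> C"
    "\<forall>f K. 0 \<le> K \<longrightarrow> (\<forall>x\<in>S. cmod (f x) \<le> K) \<longrightarrow> cmod (\<phi> f) \<le> C * K"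
    using functional_on_bound[OF \<phi>] by blast
  note C = C(1) C(2)[rule_format]
  obtain D where D: "0 \<le> D"
    "\<forall>f K. 0 \<le> K \<longrightarrow> (\<forall>x\<in>T. cmod (f x) \<le> K) \<longrightarrow> cmod (\<psi> f) \<le> D * K"
    using functional_on_bound[OF \<psi>] by blast
  note D = D(1) D(2)[rule_format]
  note bf = bounded_fun_apply[OF \<phi> _ m]
  have row: "bounded_fun S (\<lambda>t. f (m s t))" if "bounded_fun U f" "s \<in> T" for f s
    by (rule bounded_fun_compose[where h = "m s", OF that(1) m[OF that(2)]])
  show ?thesis
  proof (rule functional_onI)
    show "\<psi> (\<lambda>s. \<phi> (\<lambda>t. f (m s t))) = \<psi> (\<lambda>s. \<phi> (\<lambda>t. g (m s t)))"
      if "\<And>x. x \<in> U \<Longrightarrow> f x = g x" for f g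
      using that m by (intro functional_on_cong[OF \<psi>] functional_on_cong[OF \<phi>]) auto
  next
    fix f g assume fg: "bounded_fun U f" "bounded_fun U g"
    have "\<psi> (\<lambda>s. \<phi> (\<lambda>t. f (m s t) + g (m s t)))
        = \<psi> (\<lambda>s. \<phi> (\<lambda>t. f (m s t)) + \<phi> (\<lambda>t. g (m s t)))"
      using fg by (intro functional_on_cong[OF \<psi>] functional_on_add[OF \<phi>] row)
    then show "\<psi> (\<lambda>s. \<phi> (\<lambda>t. f (m s t) + g (m s t)))
      = \<psi> (\<lambda>s. \<phi> (\<lambda>t. f (m s t))) + \<psi> (\<lambda>s. \<phi> (\<lambda>t. g (m s t)))"
      using functional_on_add[OF \<psi> bf[OF fg(1)] bf[OF fg(2)]] by simp
  next
    fix c f assume f: "bounded_fun U f"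
    have "\<psi> (\<lambda>s. \<phi> (\<lambda>t. c * f (m s t))) = \<psi> (\<lambda>s. c * \<phi> (\<lambda>t. f (m s t)))"
      using f by (intro functional_on_cong[OF \<psi>] functional_on_scale[OF \<phi>] row)
    then show "\<psi> (\<lambda>s. \<phi> (\<lambda>t. c * f (m s t))) = c * \<psi> (\<lambda>s. \<phi> (\<lambda>t. f (m s t)))"
      using functional_on_scale[OF \<psi> bf[OF f]] by simp
  next
    fix f :: "'c \<Rightarrow> complex" and K :: real
    assume K: "0 \<le> K" "\<And>x. x \<in> U \<Longrightarrow> cmod (f x) \<le> K"
    have "cmod (\<phi> (\<lambda>t. f (m s t))) \<le> C * K" if "s \<in> T" for s
      using K(1) K(2)[OF m[OF that]] by (rule C(2))
    then have "cmod (\<psi> (\<lambda>s. \<phi> (\<lambda>t. f (m s t)))) \<le> D * (C * K)"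
      using C(1) K(1) by (intro D(2)) simp_all
    then show "cmod (\<psi> (\<lambda>s. \<phi> (\<lambda>t. f (m s t)))) \<le> D * C * K"
      by (simp add: mult.assoc)
  qed (simp add: C(1) D(1))
qed

section \<open>The dual and the bidual of the group algebra\<close>

abbreviation ell1_dual :: "('a, 'b) monoid_scheme \<Rightarrow> (('a \<Rightarrow> complex) \<Rightarrow> complex) set"
  where "ell1_dual G \<equiv> dual (ell1 G) (ell1_norm G)"

lemma ell1_summable: "a \<in> ell1 G \<Longrightarrow> (\<lambda>x. cmod (a x)) summable_on carrier G"
  by (simp add: ell1_def)

lemma ell1_outside: "a \<in> ell1 G \<Longrightarrow> x \<notin> carrier G \<Longrightarrow> a x = 0"
  by (simp add: ell1_def)

lemma ell1_zero: "(\<lambda>_. 0) \<in> ell1 G"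
  by (simp add: ell1_def)

lemma ell1_norm_zero: "ell1_norm G (\<lambda>_. 0) = 0"
  by (simp add: ell1_norm_def)

lemma ell1_norm_nonneg: "0 \<le> ell1_norm G a"
  by (simp add: ell1_norm_def infsum_nonneg)

lemma ell1_add:
  assumes "a \<in> ell1 G" "b \<in> ell1 G"
  shows "(\<lambda>x. a x + b x) \<in> ell1 G"
proof -
  have "(\<lambda>x. cmod (a x) + cmod (b x)) summable_on carrier G"
    using assms by (intro summable_on_add ell1_summable)
  then have "(\<lambda>x. cmod (a x + b x)) summable_on carrier G"
    by (rule Infinite_Sum.abs_summable_on_comparison_test') (rule norm_triangle_ineq)
  then show ?thesis
    using assms by (auto simp: ell1_def)
qed

lemma ell1_scale: "a \<in> ell1 G \<Longrightarrow> (\<lambda>x. c * a x) \<in> ell1 G"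
  by (auto simp: ell1_def norm_mult intro!: summable_on_cmult_right)

lemma ell1_restrict:
  assumes "a \<in> ell1 G"
  shows "(\<lambda>x. if x \<in> F then a x else 0) \<in> ell1 G"
proof -
  have "(\<lambda>x. cmod (if x \<in> F then a x else 0)) summable_on carrier G"
    by (rule Infinite_Sum.abs_summable_on_comparison_test'[OF ell1_summable[OF assms]]) auto
  then show ?thesis
    using assms by (auto simp: ell1_def)
qed

lemma point_mass_ell1:
  assumes "x \<in> carrier G"
  shows "point_mass x \<in> ell1 G" "ell1_norm G (point_mass x) = 1"
proof -
  have *: "((\<lambda>y. cmod (point_mass x y)) has_sum 1) (carrier G)"
    by (rule has_sum_finite_neutralI[of "{x}"]) (auto simp: point_mass_def assms)
  show "point_mass x \<in> ell1 G"
    using * assms by (auto simp: ell1_def point_mass_def summable_on_def)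
  show "ell1_norm G (point_mass x) = 1"
    using * by (simp add: ell1_norm_def infsumI)
qed

lemma dual_outside: "u \<in> dual X N \<Longrightarrow> x \<notin> X \<Longrightarrow> u x = 0"
  by (simp add: dual_def)

lemma dual_add: "u \<in> dual X N \<Longrightarrow> x \<in> X \<Longrightarrow> y \<in> X \<Longrightarrow> u (\<lambda>i. x i + y i) = u x + u y"
  by (simp add: dual_def)

lemma dual_scale: "u \<in> dual X N \<Longrightarrow> x \<in> X \<Longrightarrow> u (\<lambda>i. c * x i) = c * u x"
  by (simp add: dual_def)

lemma dual_bounded: "u \<in> dual X N \<Longrightarrow> \<exists>B. \<forall>x\<in>X. cmod (u x) \<le> B * N x"
  by (simp add: dual_def)

lemma dual_bound:
  assumes "u \<in> dual X N" "\<And>x. x \<in> X \<Longrightarrow> 0 \<le> N x"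
  shows "\<exists>B\<ge>0. \<forall>x\<in>X. cmod (u x) \<le> B * N x"
proof -
  obtain B where B: "\<forall>x\<in>X. cmod (u x) \<le> B * N x"
    using dual_bounded[OF assms(1)] by blast
  have "cmod (u x) \<le> max B 0 * N x" if "x \<in> X" for x
    using bspec[OF B that] mult_right_mono[OF max.cobounded1[of B 0] assms(2)[OF that]]
    by (rule order.trans)
  then show ?thesis
    by (intro exI[of _ "max B 0"]) simp
qed

lemma dual_add_closed:
  assumes u: "u \<in> dual X N" and v: "v \<in> dual X N"
  shows "(\<lambda>x. u x + v x) \<in> dual X N"
proof -
  obtain B where B: "\<forall>x\<in>X. cmod (u x) \<le> B * N x"
    using dual_bounded[OF u] by blast
  obtain D where D: "\<forall>x\<in>X. cmod (v x) \<le> D * N x"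
    using dual_bounded[OF v] by blast
  have "cmod (u x + v x) \<le> (B + D) * N x" if "x \<in> X" for x
    using norm_triangle_mono[OF bspec[OF B that] bspec[OF D that]] by (simp add: distrib_right)
  then have "\<exists>B. \<forall>x\<in>X. cmod (u x + v x) \<le> B * N x"
    by blast
  then show ?thesis
    using u v unfolding dual_def by (simp add: distrib_left)
qed

lemma dual_scale_closed:
  assumes u: "u \<in> dual X N"
  shows "(\<lambda>x. c * u x) \<in> dual X N"
proof -
  obtain B where B: "\<forall>x\<in>X. cmod (u x) \<le> B * N x"
    using dual_bounded[OF u] by blast
  have "cmod (c * u x) \<le> (cmod c * B) * N x" if "x \<in> X" for x
    using mult_left_mono[OF bspec[OF B that], of "cmod c"] by (simp add: norm_mult mult.assoc)
  then have "\<exists>B. \<forall>x\<in>X. cmod (c * u x) \<le> B * N x"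
    by blast
  then show ?thesis
    using u unfolding dual_def by (simp add: distrib_left)
qed

lemma dual_zero: "(\<lambda>_. 0) \<in> dual X N"
  unfolding dual_def by (auto intro: exI[of _ 0])

text \<open>A real supremum dominates its values only if the set is bounded above; lower estimates
  of \<open>dual_norm\<close> rest on this.\<close>

lemma dual_bdd_above:
  assumes "u \<in> ell1_dual G"
  shows "bdd_above ((\<lambda>x. cmod (u x)) ` {x \<in> ell1 G. ell1_norm G x \<le> 1})"
proof -
  obtain B where B: "0 \<le> B" "\<forall>x\<in>ell1 G. cmod (u x) \<le> B * ell1_norm G x"
    using dual_bound[OF assms ell1_norm_nonneg] by blast
  have "cmod (u x) \<le> B" if "x \<in> {x \<in> ell1 G. ell1_norm G x \<le> 1}" for x
    using that B(2) mult_left_le[of "ell1_norm G x" B] B(1) by fastforce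
  then show ?thesis
    by (rule bdd_aboveI2)
qed

lemma dual_norm_nonneg:
  assumes "u \<in> ell1_dual G"
  shows "0 \<le> dual_norm (ell1 G) (ell1_norm G) u"
  unfolding dual_norm_def
  by (rule cSUP_upper2[OF dual_bdd_above[OF assms], of "\<lambda>_. 0"]) (auto simp: ell1_zero ell1_norm_zero)

lemma dual_point_mass_le:
  assumes "u \<in> ell1_dual G" "x \<in> carrier G"
  shows "cmod (u (point_mass x)) \<le> dual_norm (ell1 G) (ell1_norm G) u"
  unfolding dual_norm_def
  by (rule cSUP_upper[OF _ dual_bdd_above[OF assms(1)]]) (simp add: point_mass_ell1 assms)

lemma dual_point_mass_bounded:
  "u \<in> ell1_dual G \<Longrightarrow> bounded_fun (carrier G) (\<lambda>x. u (point_mass x))"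
  by (rule bounded_funI) (rule dual_point_mass_le)

lemma linf_functional_cong:
  "(\<And>x. x \<in> carrier G \<Longrightarrow> f x = g x) \<Longrightarrow> linf_functional G f = linf_functional G g"
  unfolding linf_functional_def by (intro ext if_cong infsum_cong) auto

lemma linf_summable:
  assumes "a \<in> ell1 G" "0 \<le> K" "\<And>x. x \<in> carrier G \<Longrightarrow> cmod (f x) \<le> K"
  shows "(\<lambda>x. cmod (a x * f x)) summable_on carrier G"
    and "cmod (linf_functional G f a) \<le> K * ell1_norm G a"
proof -
  have s: "(\<lambda>x. K * cmod (a x)) summable_on carrier G"
    by (intro summable_on_cmult_right ell1_summable assms)
  have le: "cmod (a x * f x) \<le> K * cmod (a x)" if "x \<in> carrier G" for x
    using mult_left_mono[OF assms(3)[OF that], of "cmod (a x)"] by (simp add: norm_mult mult.commute)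
  show *: "(\<lambda>x. cmod (a x * f x)) summable_on carrier G"
    by (rule Infinite_Sum.abs_summable_on_comparison_test'[OF s le])
  have "cmod (linf_functional G f a) \<le> (\<Sum>\<^sub>\<infinity>x\<in>carrier G. cmod (a x * f x))"
    using assms(1) by (simp add: linf_functional_def norm_infsum_bound[OF *])
  also have "\<dots> \<le> (\<Sum>\<^sub>\<infinity>x\<in>carrier G. K * cmod (a x))"
    by (rule infsum_mono[OF * s le])
  also have "\<dots> = K * ell1_norm G a"
    by (simp add: ell1_norm_def infsum_cmult_right')
  finally show "cmod (linf_functional G f a) \<le> K * ell1_norm G a" .
qed

lemma linf_functional_dual:
  assumes "bounded_fun (carrier G) f"
  shows "linf_functional G f \<in> ell1_dual G"
proof -
  obtain K where K: "0 \<le> K" "\<And>x. x \<in> carrier G \<Longrightarrow> cmod (f x) \<le> K"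
    using bounded_funD[OF assms(1)] by blast
  have s: "(\<lambda>x. a x * f x) summable_on carrier G" if "a \<in> ell1 G" for a
    by (rule abs_summable_summable[OF linf_summable(1)[where f = f, OF that K]])
  have "\<exists>B. \<forall>a\<in>ell1 G. cmod (linf_functional G f a) \<le> B * ell1_norm G a"
    by (intro exI[of _ K] ballI linf_summable(2)[where f = f] K)
  then show ?thesis
    unfolding dual_def
    by (auto simp: linf_functional_def ell1_add ell1_scale distrib_right infsum_add s mult.assoc
        infsum_cmult_right')
qed

lemma dual_norm_linf_functional_le:
  assumes "0 \<le> K" "\<And>x. x \<in> carrier G \<Longrightarrow> cmod (f x) \<le> K"
  shows "dual_norm (ell1 G) (ell1_norm G) (linf_functional G f) \<le> K"
  unfolding dual_norm_def
proof (rule cSUP_least)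
  show "{x \<in> ell1 G. ell1_norm G x \<le> 1} \<noteq> {}"
    by (auto simp: ell1_zero ell1_norm_zero intro!: exI[of _ "\<lambda>_. 0"])
  show "cmod (linf_functional G f a) \<le> K" if "a \<in> {x \<in> ell1 G. ell1_norm G x \<le> 1}" for a
  proof -
    have "cmod (linf_functional G f a) \<le> K * ell1_norm G a"
      using that by (intro linf_summable(2)[where f = f] assms) simp_all
    also have "\<dots> \<le> K"
      using that assms(1) by (intro mult_left_le) simp_all
    finally show ?thesis .
  qed
qed

lemma linf_functional_point_mass:
  assumes "x \<in> carrier G"
  shows "linf_functional G f (point_mass x) = f x"
proof -
  have "((\<lambda>y. point_mass x y * f y) has_sum f x) (carrier G)"
    by (rule has_sum_finite_neutralI[of "{x}"]) (auto simp: point_mass_def assms)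
  then show ?thesis
    using point_mass_ell1[OF assms] by (simp add: linf_functional_def infsumI)
qed

lemma dual_finite_support:
  assumes u: "u \<in> ell1_dual G" and "finite F" "F \<subseteq> carrier G"
  shows "u (\<lambda>x. if x \<in> F then a x else 0) = (\<Sum>x\<in>F. a x * u (point_mass x))"
    and "(\<lambda>x. if x \<in> F then a x else 0) \<in> ell1 G"
proof -
  have "u (\<lambda>x. if x \<in> F then a x else 0) = (\<Sum>x\<in>F. a x * u (point_mass x))
      \<and> (\<lambda>x. if x \<in> F then a x else 0) \<in> ell1 G"
    using assms(2,3)
  proof (induction F)
    case empty
    show ?case
      using dual_scale[OF u ell1_zero, of 0] by (simp add: ell1_zero)
  next
    case (insert y F)
    have *: "(\<lambda>x. if x \<in> insert y F then a x else 0)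
        = (\<lambda>x. a y * point_mass y x + (if x \<in> F then a x else 0))"
      using insert by (auto simp: point_mass_def)
    show ?case
      unfolding * using insert
      by (simp add: dual_add[OF u] dual_scale[OF u] point_mass_ell1 ell1_scale ell1_add)
  qed
  then show "u (\<lambda>x. if x \<in> F then a x else 0) = (\<Sum>x\<in>F. a x * u (point_mass x))"
    and "(\<lambda>x. if x \<in> F then a x else 0) \<in> ell1 G" by auto
qed

text \<open>Finitely supported functions are norm dense, so a bounded functional is determined by its
  values at point masses.\<close>

lemma dual_eq_linf_functional:
  assumes u: "u \<in> ell1_dual G"
  shows "u = linf_functional G (\<lambda>x. u (point_mass x))"
proof
  fix a
  show "u a = linf_functional G (\<lambda>x. u (point_mass x)) a"
  proof (cases "a \<in> ell1 G")
    case False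
    then show ?thesis
      using dual_outside[OF u] by (simp add: linf_functional_def)
  next
    case a: True
    obtain B where B: "0 \<le> B" "\<forall>x\<in>ell1 G. cmod (u x) \<le> B * ell1_norm G x"
      using dual_bound[OF u ell1_norm_nonneg] by blast
    note B = B(1) B(2)[rule_format]
    have "((\<lambda>x. cmod (a x)) has_sum ell1_norm G a) (carrier G)"
      unfolding ell1_norm_def by (rule has_sum_infsum[OF ell1_summable[OF a]])
    then have lim: "((\<lambda>F. \<Sum>x\<in>F. cmod (a x)) \<longlongrightarrow> ell1_norm G a) (finite_subsets_at_top (carrier G))"
      by (simp add: has_sum_def)
    have "((\<lambda>F. B * (ell1_norm G a - (\<Sum>x\<in>F. cmod (a x)))) \<longlongrightarrow> B * (ell1_norm G a - ell1_norm G a))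
        (finite_subsets_at_top (carrier G))"
      by (intro tendsto_intros lim)
    then have lim0: "((\<lambda>F. B * (ell1_norm G a - (\<Sum>x\<in>F. cmod (a x)))) \<longlongrightarrow> 0)
        (finite_subsets_at_top (carrier G))"
      by simp
    \<comment> \<open>The partial sum is u of the restriction of a to F. The error is therefore u of
      the tail \<open>c\<close>, whose norm is what the partial sum misses of the norm of a.\<close>
    have est: "cmod ((\<Sum>x\<in>F. a x * u (point_mass x)) - u a)
        \<le> B * (ell1_norm G a - (\<Sum>x\<in>F. cmod (a x)))"
      if F: "finite F" "F \<subseteq> carrier G" for F
    proof -
      define b where "b = (\<lambda>x. if x \<in> F then a x else 0)"
      define c where "c = (\<lambda>x. if x \<in> - F then a x else 0)"
      have bc: "b \<in> ell1 G" "c \<in> ell1 G"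
        unfolding b_def c_def by (rule ell1_restrict[OF a])+
      have "a = (\<lambda>x. b x + c x)"
        by (auto simp: b_def c_def)
      then have ua: "u a = u b + u c"
        using dual_add[OF u bc] by simp
      have "((\<lambda>x. cmod (b x)) has_sum (\<Sum>x\<in>F. cmod (a x))) (carrier G)"
        by (rule has_sum_finite_neutralI[of F]) (use F in \<open>auto simp: b_def\<close>)
      then have nb: "infsum (\<lambda>x. cmod (b x)) (carrier G) = (\<Sum>x\<in>F. cmod (a x))"
        by (rule infsumI)
      have "ell1_norm G a = (\<Sum>\<^sub>\<infinity>x\<in>carrier G. cmod (b x) + cmod (c x))"
        unfolding ell1_norm_def by (rule infsum_cong) (auto simp: b_def c_def)
      also have "\<dots> = (\<Sum>x\<in>F. cmod (a x)) + ell1_norm G c"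
        by (simp add: infsum_add ell1_summable bc nb ell1_norm_def)
      finally have "ell1_norm G c = ell1_norm G a - (\<Sum>x\<in>F. cmod (a x))" by simp
      moreover have "(\<Sum>x\<in>F. a x * u (point_mass x)) = u b"
        unfolding b_def by (rule dual_finite_support(1)[OF u F, symmetric])
      ultimately show ?thesis
        using B(2)[OF bc(2)] by (simp add: ua)
    qed
    have "((\<lambda>F. (\<Sum>x\<in>F. a x * u (point_mass x)) - u a) \<longlongrightarrow> 0) (finite_subsets_at_top (carrier G))"
      by (rule Lim_null_comparison[OF eventually_finite_subsets_at_top_weakI lim0]) (rule est)
    then have "((\<lambda>x. a x * u (point_mass x)) has_sum u a) (carrier G)"
      by (simp add: has_sum_def Lim_null[symmetric])
    then show ?thesis
      using a by (simp add: linf_functional_def infsumI)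
  qed
qed

section \<open>Bidual elements as functionals on bounded functions\<close>

definition pairing :: "('a, 'b) monoid_scheme \<Rightarrow> 'a bidual_elem \<Rightarrow> ('a \<Rightarrow> complex) \<Rightarrow> complex"
  where "pairing G \<Phi> f = \<Phi> (linf_functional G f)"

text \<open>The inverse of \<open>pairing\<close>: the functional is fed the values of u at point
  masses. Through the two maps, bidual elements are constructed, compared and multiplied as
  functionals on bounded functions.\<close>

definition of_functional :: "('a, 'b) monoid_scheme \<Rightarrow> (('a \<Rightarrow> complex) \<Rightarrow> complex) \<Rightarrow> 'a bidual_elem"
  where "of_functional G \<phi> = (\<lambda>u. if u \<in> ell1_dual G then \<phi> (\<lambda>x. u (point_mass x)) else 0)"

lemma functional_on_pairing:
  assumes \<Phi>: "\<Phi> \<in> ell1_bidual G"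
  shows "functional_on (carrier G) (pairing G \<Phi>)"
proof -
  have \<Phi>': "\<Phi> \<in> dual (ell1_dual G) (dual_norm (ell1 G) (ell1_norm G))"
    using \<Phi> by (simp add: bidual_def)
  have "linf_functional G (\<lambda>x. f x + g x) = (\<lambda>a. linf_functional G f a + linf_functional G g a)"
    if f: "bounded_fun (carrier G) f" and g: "bounded_fun (carrier G) g" for f g
  proof
    fix a
    obtain K where K: "0 \<le> K" "\<And>x. x \<in> carrier G \<Longrightarrow> cmod (f x) \<le> K"
      using bounded_funD[OF f] by blast
    obtain L where L: "0 \<le> L" "\<And>x. x \<in> carrier G \<Longrightarrow> cmod (g x) \<le> L"
      using bounded_funD[OF g] by blast
    show "linf_functional G (\<lambda>x. f x + g x) a = linf_functional G f a + linf_functional G g a"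
      using abs_summable_summable[OF linf_summable(1)[where f = f and G = G, OF _ K]]
        abs_summable_summable[OF linf_summable(1)[where f = g and G = G, OF _ L]]
      by (simp add: linf_functional_def distrib_left infsum_add)
  qed
  moreover have "linf_functional G (\<lambda>x. c * f x) = (\<lambda>a. c * linf_functional G f a)" for c f
    by (auto simp: linf_functional_def mult.left_commute infsum_cmult_right')
  moreover obtain B where B: "0 \<le> B"
      "\<forall>u\<in>ell1_dual G. cmod (\<Phi> u) \<le> B * dual_norm (ell1 G) (ell1_norm G) u"
    using dual_bound[OF \<Phi>' dual_norm_nonneg] by blast
  moreover have "cmod (\<Phi> (linf_functional G f)) \<le> B * K"
    if "0 \<le> K" "\<forall>x\<in>carrier G. cmod (f x) \<le> K" for f K
  proof -
    have "linf_functional G f \<in> ell1_dual G"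
      using that by (intro linf_functional_dual bounded_funI[of _ _ K]) auto
    then show ?thesis
      using B dual_norm_linf_functional_le[of K G f] that
      by (meson mult_left_mono order.trans)
  qed
  ultimately show ?thesis
    unfolding pairing_def
    by (intro functional_onI[of _ _ B])
       (simp_all add: linf_functional_dual dual_add[OF \<Phi>'] dual_scale[OF \<Phi>']
        cong: linf_functional_cong)
qed

text \<open>Every element of the dual is \<open>linf_functional G f\<close> for a bounded f, so
  bounded functions detect equality in the bidual.\<close>

lemma pairing_eqI:
  assumes "\<Phi> \<in> ell1_bidual G" "\<Psi> \<in> ell1_bidual G"
    and "\<And>f. bounded_fun (carrier G) f \<Longrightarrow> pairing G \<Phi> f = pairing G \<Psi> f"
  shows "\<Phi> = \<Psi>"
proof
  fix u
  show "\<Phi> u = \<Psi> u"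
  proof (cases "u \<in> ell1_dual G")
    case False
    then show ?thesis
      using assms(1,2) by (simp add: bidual_def dual_outside)
  next
    case True
    show ?thesis
      using assms(3)[OF dual_point_mass_bounded[OF True]] dual_eq_linf_functional[OF True]
      by (simp add: pairing_def)
  qed
qed

lemma of_functional_bidual:
  assumes \<phi>: "functional_on (carrier G) \<phi>"
  shows "of_functional G \<phi> \<in> ell1_bidual G"
proof -
  obtain C where C: "0 \<le> C"
    "\<forall>f K. 0 \<le> K \<longrightarrow> (\<forall>x\<in>carrier G. cmod (f x) \<le> K) \<longrightarrow> cmod (\<phi> f) \<le> C * K"
    using functional_on_bound[OF \<phi>] by blast
  note C = C(1) C(2)[rule_format]
  have "\<forall>u\<in>ell1_dual G. cmod (of_functional G \<phi> u) \<le> C * dual_norm (ell1 G) (ell1_norm G) u"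
    by (simp add: of_functional_def C(2) dual_point_mass_le dual_norm_nonneg)
  then show ?thesis
    unfolding bidual_def dual_def[of "ell1_dual G"]
    by (auto simp: of_functional_def dual_add_closed dual_scale_closed functional_on_add[OF \<phi>] functional_on_scale[OF \<phi>]
        dual_point_mass_bounded)
qed

lemma pairing_of_functional:
  assumes \<phi>: "functional_on (carrier G) \<phi>" and f: "bounded_fun (carrier G) f"
  shows "pairing G (of_functional G \<phi>) f = \<phi> f"
proof -
  have "\<phi> (\<lambda>x. linf_functional G f (point_mass x)) = \<phi> f"
    by (rule functional_on_cong[OF \<phi>]) (rule linf_functional_point_mass)
  then show ?thesis
    by (simp add: pairing_def of_functional_def linf_functional_dual[OF f])
qed

section \<open>The algebra structure of the bidual\<close>

context group
begin

text \<open>This shear carries the absolutely summable product family a(t) b(y) to the convolution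
  kernel a(t) b(t^-1 x), where x = t y.\<close>

lemma translate_bij_betw: "bij_betw (\<lambda>(t, y). (t \<otimes> y, t)) (carrier G \<times> carrier G) (carrier G \<times> carrier G)"
  by (rule bij_betwI[where g = "\<lambda>(x, t). (t, inv t \<otimes> x)"]) (auto simp: m_assoc[symmetric])

lemma convolution_kernel:
  assumes a: "a \<in> ell1 G" and b: "b \<in> ell1 G"
  shows "(\<lambda>(x, t). cmod (a t * b (inv t \<otimes> x))) summable_on (carrier G \<times> carrier G)"
    and "(\<Sum>\<^sub>\<infinity>(x, t)\<in>carrier G \<times> carrier G. cmod (a t * b (inv t \<otimes> x))) = ell1_norm G a * ell1_norm G b"
proof -
  let ?S = "carrier G" and ?h = "\<lambda>(x, t). cmod (a t * b (inv t \<otimes> x))"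
  have eq: "?h ((\<lambda>(t, y). (t \<otimes> y, t)) p) = (\<lambda>(t, y). cmod (a t * b y)) p" if "p \<in> ?S \<times> ?S" for p
    using that by (auto simp: m_assoc[symmetric])
  have "(\<lambda>p. norm ((\<lambda>(t, y). a t * b y) p)) summable_on ?S \<times> ?S"
    by (subst Infinite_Sum.abs_summable_on_Sigma_iff)
       (auto simp: norm_mult infsum_cmult_right' abs_mult infsum_nonneg
          intro!: summable_on_cmult_right summable_on_cmult_left ell1_summable a b)
  then have s: "(\<lambda>(t, y). cmod (a t * b y)) summable_on ?S \<times> ?S"
    by (simp add: case_prod_unfold)
  have "(\<lambda>p. ?h ((\<lambda>(t, y). (t \<otimes> y, t)) p)) summable_on ?S \<times> ?S"
    using s by (rule iffD2[OF summable_on_cong, rotated]) (rule eq)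
  then show "?h summable_on (?S \<times> ?S)"
    by (rule iffD1[OF summable_on_reindex_bij_betw[OF translate_bij_betw]])
  have "infsum ?h (?S \<times> ?S) = (\<Sum>\<^sub>\<infinity>p\<in>?S \<times> ?S. ?h ((\<lambda>(t, y). (t \<otimes> y, t)) p))"
    by (rule infsum_reindex_bij_betw[OF translate_bij_betw, symmetric])
  also have "\<dots> = infsum (\<lambda>(t, y). cmod (a t * b y)) (?S \<times> ?S)"
    by (rule infsum_cong) (rule eq)
  also have "\<dots> = (\<Sum>\<^sub>\<infinity>t\<in>?S. \<Sum>\<^sub>\<infinity>y\<in>?S. cmod (a t * b y))"
    using infsum_Sigma_banach[OF s] by simp
  also have "\<dots> = ell1_norm G a * ell1_norm G b"
    by (simp add: norm_mult infsum_cmult_right' infsum_cmult_left' ell1_norm_def)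
  finally show "infsum ?h (?S \<times> ?S) = ell1_norm G a * ell1_norm G b" .
qed

text \<open>Fubini for the kernel, sliced along x: each convolution sum converges absolutely, and
  the slices add up to the product of the norms.\<close>

lemma convolution_rows:
  assumes a: "a \<in> ell1 G" and b: "b \<in> ell1 G"
  shows "x \<in> carrier G \<Longrightarrow> (\<lambda>t. cmod (a t * b (inv t \<otimes> x))) summable_on carrier G"
    and "(\<lambda>x. \<Sum>\<^sub>\<infinity>t\<in>carrier G. cmod (a t * b (inv t \<otimes> x))) summable_on carrier G"
    and "(\<Sum>\<^sub>\<infinity>x\<in>carrier G. \<Sum>\<^sub>\<infinity>t\<in>carrier G. cmod (a t * b (inv t \<otimes> x))) = ell1_norm G a * ell1_norm G b"
proof -
  let ?h = "\<lambda>(x, t). a t * b (inv t \<otimes> x)"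
  have "(\<lambda>p. norm (?h p)) summable_on carrier G \<times> carrier G"
    using convolution_kernel(1)[OF a b] by (simp add: case_prod_unfold)
  then have *: "(\<forall>x\<in>carrier G. (\<lambda>t. norm (?h (x, t))) summable_on carrier G)
      \<and> (\<lambda>x. norm (\<Sum>\<^sub>\<infinity>t\<in>carrier G. norm (?h (x, t)))) summable_on carrier G"
    by (subst (asm) Infinite_Sum.abs_summable_on_Sigma_iff)
  show "x \<in> carrier G \<Longrightarrow> (\<lambda>t. cmod (a t * b (inv t \<otimes> x))) summable_on carrier G"
    using * by simp
  show "(\<lambda>x. \<Sum>\<^sub>\<infinity>t\<in>carrier G. cmod (a t * b (inv t \<otimes> x))) summable_on carrier G"
    using conjunct2[OF *] by (simp add: infsum_nonneg)
  show "(\<Sum>\<^sub>\<infinity>x\<in>carrier G. \<Sum>\<^sub>\<infinity>t\<in>carrier G. cmod (a t * b (inv t \<otimes> x))) = ell1_norm G a * ell1_norm G b"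
    using infsum_Sigma_banach[OF convolution_kernel(1)[OF a b]] convolution_kernel(2)[OF a b] by simp
qed

lemma convolution_ell1:
  assumes a: "a \<in> ell1 G" and b: "b \<in> ell1 G"
  shows "convolution G a b \<in> ell1 G"
    and "ell1_norm G (convolution G a b) \<le> ell1_norm G a * ell1_norm G b"
proof -
  have le: "cmod (convolution G a b x) \<le> (\<Sum>\<^sub>\<infinity>t\<in>carrier G. cmod (a t * b (inv t \<otimes> x)))"
    if "x \<in> carrier G" for x
    using that norm_infsum_bound[OF convolution_rows(1)[OF a b that]] by (simp add: convolution_def)
  have s: "(\<lambda>x. cmod (convolution G a b x)) summable_on carrier G"
    by (rule Infinite_Sum.abs_summable_on_comparison_test'[OF convolution_rows(2)[OF a b] le])
  show "convolution G a b \<in> ell1 G"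
    using s by (simp add: ell1_def convolution_def)
  show "ell1_norm G (convolution G a b) \<le> ell1_norm G a * ell1_norm G b"
    unfolding ell1_norm_def[of G "convolution G a b"] convolution_rows(3)[OF a b, symmetric]
    by (rule infsum_mono[OF s convolution_rows(2)[OF a b] le])
qed

lemma convolution_add_left:
  assumes "a \<in> ell1 G" "a' \<in> ell1 G" "b \<in> ell1 G"
  shows "convolution G (\<lambda>x. a x + a' x) b = (\<lambda>x. convolution G a b x + convolution G a' b x)"
  using abs_summable_summable[OF convolution_rows(1)[OF assms(1,3)]]
    abs_summable_summable[OF convolution_rows(1)[OF assms(2,3)]]
  by (intro ext) (simp add: convolution_def distrib_right infsum_add)

lemma convolution_add_right:
  assumes "a \<in> ell1 G" "b \<in> ell1 G" "b' \<in> ell1 G"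
  shows "convolution G a (\<lambda>x. b x + b' x) = (\<lambda>x. convolution G a b x + convolution G a b' x)"
  using abs_summable_summable[OF convolution_rows(1)[OF assms(1,2)]]
    abs_summable_summable[OF convolution_rows(1)[OF assms(1,3)]]
  by (intro ext) (simp add: convolution_def distrib_left infsum_add)

lemma convolution_scale_left: "convolution G (\<lambda>x. c * a x) b = (\<lambda>x. c * convolution G a b x)"
  by (intro ext) (simp add: convolution_def mult.assoc infsum_cmult_right')

lemma convolution_scale_right: "convolution G a (\<lambda>x. c * b x) = (\<lambda>x. c * convolution G a b x)"
  by (intro ext) (simp add: convolution_def mult.left_commute infsum_cmult_right')

lemma convolution_point_mass:
  assumes "s \<in> carrier G" "t \<in> carrier G"
  shows "convolution G (point_mass s) (point_mass t) = point_mass (s \<otimes> t)"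
proof
  fix x
  show "convolution G (point_mass s) (point_mass t) x = point_mass (s \<otimes> t) x"
  proof (cases "x \<in> carrier G")
    case True
    have "((\<lambda>r. point_mass s r * point_mass t (inv r \<otimes> x)) has_sum point_mass t (inv s \<otimes> x)) (carrier G)"
      by (rule has_sum_finite_neutralI[of "{s}"]) (auto simp: point_mass_def assms)
    moreover have "inv s \<otimes> x = t \<longleftrightarrow> x = s \<otimes> t"
      using assms True by (metis inv_solve_left)
    ultimately show ?thesis
      using True by (simp add: convolution_def infsumI point_mass_def)
  next
    case False
    then show ?thesis
      using assms by (auto simp: convolution_def point_mass_def)
  qed
qed

section \<open>Module actions and the Arens product as iterated evaluation\<close>

lemma dual_right_act_dual:
  assumes u: "u \<in> ell1_dual G" and a: "a \<in> ell1 G"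
  shows "dual_right_act (ell1 G) (convolution G) u a \<in> ell1_dual G"
proof -
  obtain B where B: "0 \<le> B" "\<forall>x\<in>ell1 G. cmod (u x) \<le> B * ell1_norm G x"
    using dual_bound[OF u ell1_norm_nonneg] by blast
  have "cmod (u (convolution G a b)) \<le> (B * ell1_norm G a) * ell1_norm G b" if b: "b \<in> ell1 G" for b
    using bspec[OF B(2) convolution_ell1(1)[OF a b]]
      mult_left_mono[OF convolution_ell1(2)[OF a b] B(1)] by (simp add: mult.assoc)
  then have "\<exists>B. \<forall>b\<in>ell1 G. cmod (u (convolution G a b)) \<le> B * ell1_norm G b"
    by blast
  then show ?thesis
    unfolding dual_def
    by (simp add: dual_right_act_def ell1_add ell1_scale convolution_add_right[OF a] a
        convolution_scale_right dual_add[OF u] dual_scale[OF u] convolution_ell1)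
qed

text \<open>A bounded functional is determined at point masses, and there convolution is the group
  multiplication.\<close>

lemma dual_right_act_point_mass:
  assumes f: "bounded_fun (carrier G) f" and s: "s \<in> carrier G"
  shows "dual_right_act (ell1 G) (convolution G) (linf_functional G f) (point_mass s)
    = linf_functional G (\<lambda>t. f (s \<otimes> t))"
proof -
  let ?v = "dual_right_act (ell1 G) (convolution G) (linf_functional G f) (point_mass s)"
  have "?v \<in> ell1_dual G"
    by (intro dual_right_act_dual linf_functional_dual f point_mass_ell1 s)
  then have "?v = linf_functional G (\<lambda>t. ?v (point_mass t))"
    by (rule dual_eq_linf_functional)
  also have "\<dots> = linf_functional G (\<lambda>t. f (s \<otimes> t))"
    by (rule linf_functional_cong)
       (simp add: dual_right_act_def point_mass_ell1 convolution_point_mass linf_functional_point_mass s)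
  finally show ?thesis .
qed

lemma bidual_left_act_dual:
  assumes \<Phi>: "\<Phi> \<in> ell1_bidual G" and u: "u \<in> ell1_dual G"
  shows "bidual_left_act (ell1 G) (convolution G) \<Phi> u \<in> ell1_dual G"
proof -
  let ?act = "dual_right_act (ell1 G) (convolution G) u"
  have \<Phi>': "\<Phi> \<in> dual (ell1_dual G) (dual_norm (ell1 G) (ell1_norm G))"
    using \<Phi> by (simp add: bidual_def)
  obtain B where B: "0 \<le> B" "\<forall>x\<in>ell1 G. cmod (u x) \<le> B * ell1_norm G x"
    using dual_bound[OF u ell1_norm_nonneg] by blast
  obtain D where D: "0 \<le> D" "\<forall>v\<in>ell1_dual G. cmod (\<Phi> v) \<le> D * dual_norm (ell1 G) (ell1_norm G) v"
    using dual_bound[OF \<Phi>' dual_norm_nonneg] by blast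
  have norm: "dual_norm (ell1 G) (ell1_norm G) (?act a) \<le> B * ell1_norm G a" if a: "a \<in> ell1 G" for a
    unfolding dual_norm_def
  proof (rule cSUP_least)
    show "{x \<in> ell1 G. ell1_norm G x \<le> 1} \<noteq> {}"
      by (auto simp: ell1_zero ell1_norm_zero intro!: exI[of _ "\<lambda>_. 0"])
    fix b assume "b \<in> {x \<in> ell1 G. ell1_norm G x \<le> 1}"
    then have b: "b \<in> ell1 G" "ell1_norm G b \<le> 1" by auto
    have "cmod (?act a b) \<le> B * ell1_norm G (convolution G a b)"
      using b(1) bspec[OF B(2) convolution_ell1(1)[OF a b(1)]] by (simp add: dual_right_act_def)
    also have "\<dots> \<le> B * (ell1_norm G a * ell1_norm G b)"
      by (rule mult_left_mono[OF convolution_ell1(2)[OF a b(1)] B(1)])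
    also have "\<dots> \<le> B * ell1_norm G a"
      using B(1) b(2) ell1_norm_nonneg by (intro mult_left_mono mult_left_le)
    finally show "cmod (?act a b) \<le> B * ell1_norm G a" .
  qed
  have "cmod (\<Phi> (?act a)) \<le> (D * B) * ell1_norm G a" if a: "a \<in> ell1 G" for a
    using bspec[OF D(2) dual_right_act_dual[OF u a]] mult_left_mono[OF norm[OF a] D(1)]
    by (simp add: mult.assoc)
  then have "\<exists>C. \<forall>a\<in>ell1 G. cmod (\<Phi> (?act a)) \<le> C * ell1_norm G a"
    by blast
  moreover have "?act (\<lambda>x. a x + a' x) = (\<lambda>b. ?act a b + ?act a' b)"
    if "a \<in> ell1 G" "a' \<in> ell1 G" for a a'
    by (intro ext)
       (simp add: dual_right_act_def convolution_add_left[OF that] dual_add[OF u] convolution_ell1 that)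
  moreover have "?act (\<lambda>x. c * a x) = (\<lambda>b. c * ?act a b)" if "a \<in> ell1 G" for a c
    by (intro ext)
       (simp add: dual_right_act_def convolution_scale_left dual_scale[OF u] convolution_ell1 that)
  ultimately show ?thesis
    unfolding dual_def
    by (simp add: bidual_left_act_def ell1_add ell1_scale dual_add[OF \<Phi>'] dual_scale[OF \<Phi>']
        dual_right_act_dual u)
qed

lemma bidual_left_act_linf:
  assumes \<Phi>: "\<Phi> \<in> ell1_bidual G" and f: "bounded_fun (carrier G) f"
  shows "bidual_left_act (ell1 G) (convolution G) \<Phi> (linf_functional G f)
    = linf_functional G (\<lambda>s. pairing G \<Phi> (\<lambda>t. f (s \<otimes> t)))"
proof -
  let ?v = "bidual_left_act (ell1 G) (convolution G) \<Phi> (linf_functional G f)"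
  have "?v = linf_functional G (\<lambda>s. ?v (point_mass s))"
    by (intro dual_eq_linf_functional bidual_left_act_dual \<Phi> linf_functional_dual f)
  also have "\<dots> = linf_functional G (\<lambda>s. pairing G \<Phi> (\<lambda>t. f (s \<otimes> t)))"
    by (rule linf_functional_cong)
       (simp add: bidual_left_act_def point_mass_ell1 dual_right_act_point_mass[OF f] pairing_def)
  finally show ?thesis .
qed

text \<open>As operators on bounded functions, the right factor acts first and the left factor
  stands outside. Associativity, distributivity and the action of powers are all read off from this
  formula.\<close>

lemma pairing_arens:
  assumes \<Phi>: "\<Phi> \<in> ell1_bidual G" and f: "bounded_fun (carrier G) f"
  shows "pairing G (arens G \<Psi> \<Phi>) f = pairing G \<Psi> (\<lambda>s. pairing G \<Phi> (\<lambda>t. f (s \<otimes> t)))"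
  by (subst (1 2) pairing_def)
     (simp add: arens_def arens_product_def linf_functional_dual[OF f] bidual_left_act_linf[OF \<Phi> f])

lemma bounded_fun_pairing:
  assumes "\<Phi> \<in> ell1_bidual G" "bounded_fun (carrier G) f"
  shows "bounded_fun (carrier G) (\<lambda>s. pairing G \<Phi> (\<lambda>t. f (s \<otimes> t)))"
  by (rule bounded_fun_apply[OF functional_on_pairing[OF assms(1)] assms(2)]) simp

lemma bounded_fun_translate:
  assumes "bounded_fun (carrier G) f" "s \<in> carrier G"
  shows "bounded_fun (carrier G) (\<lambda>t. f (s \<otimes> t))"
  by (rule bounded_fun_compose[OF assms(1)]) (simp add: assms(2))

text \<open>Boundedness is inherited from \<open>functional_on_iterate\<close>; it remains to
  recognise the product as \<open>of_functional\<close> of the iterated functional.\<close>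

lemma arens_bidual:
  assumes \<Psi>: "\<Psi> \<in> ell1_bidual G" and \<Phi>: "\<Phi> \<in> ell1_bidual G"
  shows "arens G \<Psi> \<Phi> \<in> ell1_bidual G"
proof -
  let ?\<phi> = "\<lambda>f. pairing G \<Psi> (\<lambda>s. pairing G \<Phi> (\<lambda>t. f (s \<otimes> t)))"
  have "functional_on (carrier G) ?\<phi>"
    by (rule functional_on_iterate[OF functional_on_pairing[OF \<Psi>] functional_on_pairing[OF \<Phi>]]) simp
  then have "of_functional G ?\<phi> \<in> ell1_bidual G"
    by (rule of_functional_bidual)
  moreover have "arens G \<Psi> \<Phi> = of_functional G ?\<phi>"
  proof
    fix u
    show "arens G \<Psi> \<Phi> u = of_functional G ?\<phi> u"
    proof (cases "u \<in> ell1_dual G")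
      case True
      let ?f = "\<lambda>x. u (point_mass x)"
      have "arens G \<Psi> \<Phi> u = pairing G (arens G \<Psi> \<Phi>) ?f"
        using dual_eq_linf_functional[OF True] by (simp add: pairing_def)
      also have "\<dots> = ?\<phi> ?f"
        by (rule pairing_arens[OF \<Phi> dual_point_mass_bounded[OF True]])
      finally show ?thesis
        using True by (simp add: of_functional_def)
    qed (simp add: arens_def arens_product_def of_functional_def)
  qed
  ultimately show ?thesis by simp
qed

lemma delta_bidual:
  assumes "s \<in> carrier G"
  shows "delta G s \<in> ell1_bidual G"
proof -
  have "functional_on (carrier G) (\<lambda>f. f s)"
    by (rule functional_onI[of _ _ 1]) (use assms in auto)
  then have "of_functional G (\<lambda>f. f s) \<in> ell1_bidual G"
    by (rule of_functional_bidual)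
  then show ?thesis
    by (simp add: delta_def bidual_embed_def of_functional_def)
qed

lemma pairing_delta:
  assumes "s \<in> carrier G" "bounded_fun (carrier G) f"
  shows "pairing G (delta G s) f = f s"
  using assms
  by (simp add: pairing_def delta_def bidual_embed_def linf_functional_dual linf_functional_point_mass)

section \<open>Ring axioms for the bidual\<close>

lemma bidual_ring_simps:
  "carrier (bidual_ring G) = ell1_bidual G" "mult (bidual_ring G) = arens G"
  "one (bidual_ring G) = delta G \<one>" "zero (bidual_ring G) = (\<lambda>_. 0)"
  "add (bidual_ring G) = (\<lambda>\<Phi> \<Psi> u. \<Phi> u + \<Psi> u)"
  by (simp_all add: bidual_ring_def)

lemma ell1_bidual_add:
  "\<Phi> \<in> ell1_bidual G \<Longrightarrow> \<Psi> \<in> ell1_bidual G \<Longrightarrow> (\<lambda>u. \<Phi> u + \<Psi> u) \<in> ell1_bidual G"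
  unfolding bidual_def by (rule dual_add_closed)

lemma ell1_bidual_scale: "\<Phi> \<in> ell1_bidual G \<Longrightarrow> (\<lambda>u. c * \<Phi> u) \<in> ell1_bidual G"
  unfolding bidual_def by (rule dual_scale_closed)

lemma ell1_bidual_zero: "(\<lambda>_. 0) \<in> ell1_bidual G"
  unfolding bidual_def by (rule dual_zero)

lemma pairing_plus: "pairing G (\<lambda>u. \<Phi> u + \<Psi> u) f = pairing G \<Phi> f + pairing G \<Psi> f"
  by (simp add: pairing_def)

lemma arens_assoc:
  assumes "\<Phi> \<in> ell1_bidual G" "\<Psi> \<in> ell1_bidual G" "\<Theta> \<in> ell1_bidual G"
  shows "arens G (arens G \<Phi> \<Psi>) \<Theta> = arens G \<Phi> (arens G \<Psi> \<Theta>)"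
proof (rule pairing_eqI)
  fix f :: "'a \<Rightarrow> complex" assume f: "bounded_fun (carrier G) f"
  have "pairing G (arens G \<Phi> (arens G \<Psi> \<Theta>)) f
      = pairing G \<Phi> (\<lambda>r. pairing G (arens G \<Psi> \<Theta>) (\<lambda>t. f (r \<otimes> t)))"
    by (rule pairing_arens[OF arens_bidual[OF assms(2,3)] f])
  also have "\<dots> = pairing G \<Phi> (\<lambda>r. pairing G \<Psi> (\<lambda>s. pairing G \<Theta> (\<lambda>t. f (r \<otimes> (s \<otimes> t)))))"
    by (intro functional_on_cong[OF functional_on_pairing[OF assms(1)]])
       (simp add: pairing_arens assms bounded_fun_translate f)
  also have "\<dots> = pairing G \<Phi> (\<lambda>r. pairing G \<Psi> (\<lambda>s. pairing G \<Theta> (\<lambda>t. f (r \<otimes> s \<otimes> t))))"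
    by (intro functional_on_cong[OF functional_on_pairing] assms) (simp add: m_assoc)
  also have "\<dots> = pairing G (arens G (arens G \<Phi> \<Psi>) \<Theta>) f"
    by (simp add: pairing_arens assms f bounded_fun_pairing)
  finally show "pairing G (arens G (arens G \<Phi> \<Psi>) \<Theta>) f = pairing G (arens G \<Phi> (arens G \<Psi> \<Theta>)) f"
    by simp
qed (intro arens_bidual assms)+

lemma ring_bidual_ring: "ring (bidual_ring G)"
proof (rule ringI)
  show "abelian_group (bidual_ring G)"
  proof (rule abelian_groupI, unfold bidual_ring_simps)
    fix \<Phi> assume \<Phi>: "\<Phi> \<in> ell1_bidual G"
    show "\<exists>\<Psi>\<in>ell1_bidual G. (\<lambda>u. \<Psi> u + \<Phi> u) = (\<lambda>_. 0)"
      by (rule bexI[OF _ ell1_bidual_scale[OF \<Phi>, of "- 1"]]) simp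
  qed (simp_all add: ell1_bidual_add ell1_bidual_zero add_ac)
  show "Group.monoid (bidual_ring G)"
  proof (rule Group.monoidI, unfold bidual_ring_simps)
    fix \<Phi> assume \<Phi>: "\<Phi> \<in> ell1_bidual G"
    show "arens G (delta G \<one>) \<Phi> = \<Phi>"
    proof (rule pairing_eqI)
      fix f :: "'a \<Rightarrow> complex" assume f: "bounded_fun (carrier G) f"
      show "pairing G (arens G (delta G \<one>) \<Phi>) f = pairing G \<Phi> f"
        using functional_on_cong[OF functional_on_pairing[OF \<Phi>], of "\<lambda>t. f (\<one> \<otimes> t)" f]
        by (simp add: pairing_arens \<Phi> f pairing_delta bounded_fun_pairing)
    qed (intro arens_bidual delta_bidual one_closed \<Phi>)+
    show "arens G \<Phi> (delta G \<one>) = \<Phi>"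
    proof (rule pairing_eqI)
      fix f :: "'a \<Rightarrow> complex" assume f: "bounded_fun (carrier G) f"
      have "pairing G (arens G \<Phi> (delta G \<one>)) f = pairing G \<Phi> (\<lambda>s. pairing G (delta G \<one>) (\<lambda>t. f (s \<otimes> t)))"
        by (rule pairing_arens[OF delta_bidual[OF one_closed] f])
      also have "\<dots> = pairing G \<Phi> f"
        by (rule functional_on_cong[OF functional_on_pairing[OF \<Phi>]])
           (simp add: pairing_delta bounded_fun_translate f)
      finally show "pairing G (arens G \<Phi> (delta G \<one>)) f = pairing G \<Phi> f" .
    qed (intro arens_bidual delta_bidual one_closed \<Phi>)+
  qed (simp_all add: arens_bidual delta_bidual arens_assoc)
next
  fix \<Phi> \<Psi> \<Theta>
  assume "\<Phi> \<in> carrier (bidual_ring G)" "\<Psi> \<in> carrier (bidual_ring G)" "\<Theta> \<in> carrier (bidual_ring G)"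
  then have *: "\<Phi> \<in> ell1_bidual G" "\<Psi> \<in> ell1_bidual G" "\<Theta> \<in> ell1_bidual G"
    by (simp_all add: bidual_ring_simps)
  show "(\<Phi> \<oplus>\<^bsub>bidual_ring G\<^esub> \<Psi>) \<otimes>\<^bsub>bidual_ring G\<^esub> \<Theta>
      = \<Phi> \<otimes>\<^bsub>bidual_ring G\<^esub> \<Theta> \<oplus>\<^bsub>bidual_ring G\<^esub> \<Psi> \<otimes>\<^bsub>bidual_ring G\<^esub> \<Theta>"
    unfolding bidual_ring_simps
    by (intro pairing_eqI[where G = G] arens_bidual ell1_bidual_add *)
       (simp add: pairing_plus pairing_arens *)
  show "\<Theta> \<otimes>\<^bsub>bidual_ring G\<^esub> (\<Phi> \<oplus>\<^bsub>bidual_ring G\<^esub> \<Psi>)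
      = \<Theta> \<otimes>\<^bsub>bidual_ring G\<^esub> \<Phi> \<oplus>\<^bsub>bidual_ring G\<^esub> \<Theta> \<otimes>\<^bsub>bidual_ring G\<^esub> \<Psi>"
    unfolding bidual_ring_simps
    by (intro pairing_eqI[where G = G] arens_bidual ell1_bidual_add *)
       (simp add: pairing_plus pairing_arens ell1_bidual_add * bounded_fun_pairing
          functional_on_add[OF functional_on_pairing])
qed

end

section \<open>Elements generating nil left ideals\<close>

text \<open>If x lies outside a maximal left ideal I, then I + R x = R, so 1 = i + z with i in I and
  z in R x. Thus 1 - z is in I, hence so is 1 - z^n for every n, and nilpotency of z puts 1 into
  I.\<close>

lemma (in ring) jacobson_radicalI:
  assumes x: "x \<in> carrier R"
    and nil: "\<And>y. y \<in> carrier R \<Longrightarrow> \<exists>n::nat. (y \<otimes> x) [^] n = \<zero>"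
  shows "x \<in> jacobson_radical R"
proof -
  have "x \<in> I" if max: "maximal_left_ideal I R" for I
  proof (rule ccontr)
    assume "x \<notin> I"
    have I: "additive_subgroup I R" and lI: "\<And>a i. a \<in> carrier R \<Longrightarrow> i \<in> I \<Longrightarrow> a \<otimes> i \<in> I"
      and ne: "I \<noteq> carrier R"
      using max by (auto simp: maximal_left_ideal_def left_ideal_def)
    interpret I: additive_subgroup I R by (rule I)
    have Icarr: "i \<in> carrier R" if "i \<in> I" for i
      using that I.a_subset by blast
    have Iinv: "\<ominus> i \<in> I" if "i \<in> I" for i
      using lI[of "\<ominus> \<one>" i] that by (simp add: l_minus Icarr)
    define J where "J = {i \<oplus> y \<otimes> x |i y. i \<in> I \<and> y \<in> carrier R}"
    have "additive_subgroup J R"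
    proof (intro additive_subgroupI add.subgroupI)
      show "J \<subseteq> carrier R"
        using x by (auto simp: J_def Icarr)
      have "\<zero> \<oplus> \<zero> \<otimes> x \<in> J"
        using I.zero_closed unfolding J_def by blast
      then show "J \<noteq> {}" by blast
      fix a assume "a \<in> J"
      then obtain i y where iy: "i \<in> I" "y \<in> carrier R" "a = i \<oplus> y \<otimes> x"
        by (auto simp: J_def)
      have "\<ominus> a = \<ominus> i \<oplus> (\<ominus> y) \<otimes> x"
        using iy x by (simp add: Icarr minus_add l_minus)
      then show "\<ominus> a \<in> J"
        using iy Iinv unfolding J_def by blast
      fix b assume "b \<in> J"
      then obtain i' y' where iy': "i' \<in> I" "y' \<in> carrier R" "b = i' \<oplus> y' \<otimes> x"
        by (auto simp: J_def)
      have "a \<oplus> b = (i \<oplus> i') \<oplus> (y \<oplus> y') \<otimes> x"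
        using iy iy' x by (simp add: Icarr l_distr a_ac)
      then show "a \<oplus> b \<in> J"
        using iy iy' unfolding J_def by blast
    qed
    moreover have "a \<otimes> b \<in> J" if "a \<in> carrier R" "b \<in> J" for a b
    proof -
      obtain i y where iy: "i \<in> I" "y \<in> carrier R" "b = i \<oplus> y \<otimes> x"
        using \<open>b \<in> J\<close> by (auto simp: J_def)
      have "a \<otimes> b = a \<otimes> i \<oplus> (a \<otimes> y) \<otimes> x"
        using iy x that(1) by (simp add: Icarr r_distr m_assoc)
      then show ?thesis
        using iy lI that(1) unfolding J_def by blast
    qed
    ultimately have "left_ideal J R"
      by (simp add: left_ideal_def)
    moreover have "I \<subseteq> J"
    proof
      fix i assume "i \<in> I"
      then have "i = i \<oplus> \<zero> \<otimes> x"
        using x by (simp add: Icarr)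
      then show "i \<in> J"
        using \<open>i \<in> I\<close> unfolding J_def by blast
    qed
    moreover have "x \<in> J"
    proof -
      have "x = \<zero> \<oplus> \<one> \<otimes> x"
        using x by simp
      then show ?thesis
        using I.zero_closed unfolding J_def by blast
    qed
    ultimately have "J = carrier R"
      using max \<open>x \<notin> I\<close> unfolding maximal_left_ideal_def by blast
    then obtain i y where iy: "i \<in> I" "y \<in> carrier R" "\<one> = i \<oplus> y \<otimes> x"
      using one_closed unfolding J_def by blast
    define z where "z = y \<otimes> x"
    have z: "z \<in> carrier R"
      using iy x by (simp add: z_def)
    have "i = \<one> \<ominus> z"
      using iy z unfolding z_def[symmetric] by (simp add: Icarr minus_eq a_assoc r_neg)
    then have zI: "\<one> \<ominus> z \<in> I"
      using iy by simp
    have pow: "\<one> \<ominus> z [^] (n::nat) \<in> I" for n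
    proof (induction n)
      case 0
      show ?case
        by (simp add: minus_eq r_neg)
    next
      case (Suc n)
      \<comment> \<open>Telescoping with z^n on the left of 1 - z, because I absorbs multiplication
        only from the left.\<close>
      have "\<one> \<ominus> z [^] Suc n = (\<one> \<ominus> z [^] n) \<oplus> z [^] n \<otimes> (\<one> \<ominus> z)"
        using z by (simp add: minus_eq r_distr r_minus a_assoc r_neg1)
      then show ?case
        using Suc lI[OF nat_pow_closed[OF z] zI] by simp
    qed
    obtain n :: nat where "z [^] n = \<zero>"
      using nil[OF iy(2)] by (auto simp: z_def)
    then have "\<one> \<in> I"
      using pow[of n] by (simp add: minus_eq)
    then have "carrier R \<subseteq> I"
      using lI by (metis r_one subsetI)
    then show False
      using ne I.a_subset by blast
  qed
  then show ?thesis
    using x by (simp add: jacobson_radical_def)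
qed

section \<open>Invariant differences on infinite amenable groups\<close>

text \<open>The functionals on bounded functions that correspond to invariant differences.\<close>

definition (in group) invariant_diff :: "'a set \<Rightarrow> (('a \<Rightarrow> complex) \<Rightarrow> complex) \<Rightarrow> bool"
  where "invariant_diff L \<gamma> \<longleftrightarrow> functional_on L \<gamma>
     \<and> (\<forall>f s. bounded_fun L f \<longrightarrow> s \<in> L \<longrightarrow> \<gamma> (\<lambda>t. f (s \<otimes> t)) = \<gamma> f) \<and> \<gamma> (\<lambda>_. 1) = 0"

context group
begin

lemma amenable_imp_mean:
  assumes "amenable G"
  shows "\<exists>M. functional_on (carrier G) M \<and> M (\<lambda>_. 1) = 1
    \<and> (\<forall>f s. bounded_fun (carrier G) f \<longrightarrow> s \<in> carrier G \<longrightarrow> M (\<lambda>t. f (s \<otimes> t)) = M f)"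
proof -
  obtain M where M: "M \<in> ell1_bidual G" "M (linf_functional G (\<lambda>_. 1)) = 1"
    and inv: "\<forall>s\<in>carrier G. arens G (delta G s) M = M"
    using assms by (auto simp: amenable_def)
  have "pairing G M (\<lambda>t. f (s \<otimes> t)) = pairing G M f"
    if "bounded_fun (carrier G) f" "s \<in> carrier G" for f s
  proof -
    have "pairing G M f = pairing G (arens G (delta G s) M) f"
      using inv that(2) by simp
    also have "\<dots> = pairing G M (\<lambda>t. f (s \<otimes> t))"
      using that M(1) by (simp add: pairing_arens pairing_delta bounded_fun_pairing)
    finally show ?thesis by simp
  qed
  then show ?thesis
    using functional_on_pairing[OF M(1)] M(2)
    by (intro exI[of _ "pairing G M"]) (simp add: pairing_def)
qed

text \<open>Take g c(g)^-1 with c(g) a representative of the coset K g. Composition with such a map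
  turns functions on K into functions on G compatibly with left translation by K, so an invariant
  mean on G yields one on K.\<close>

lemma equivariant_retraction:
  assumes K: "subgroup K G"
  shows "\<exists>\<pi>. (\<forall>g\<in>carrier G. \<pi> g \<in> K) \<and> (\<forall>k\<in>K. \<forall>g\<in>carrier G. \<pi> (k \<otimes> g) = k \<otimes> \<pi> g)"
proof -
  interpret K: subgroup K G by (rule K)
  \<comment> \<open>The representative is chosen from the coset as a set, so elements of the same
    coset receive the same one; equivariance depends on this.\<close>
  define c where "c g = (SOME c. c \<in> K #> g)" for g
  have c: "c g \<in> K #> g" if "g \<in> carrier G" for g
    unfolding c_def by (rule someI[of _ g]) (rule rcos_self[OF that K])
  have cc: "c g \<in> carrier G" if "g \<in> carrier G" for g
    using c[OF that] r_coset_subset_G[OF K.subset that] by blast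
  have "g \<otimes> inv (c g) \<in> K" if g: "g \<in> carrier G" for g
  proof -
    obtain k where k: "k \<in> K" "c g = k \<otimes> g"
      using c[OF g] by (auto simp: r_coset_def)
    have "g \<otimes> inv (c g) = inv k"
      using k g K.subset by (auto simp: inv_mult_group m_assoc[symmetric])
    then show ?thesis
      using k by simp
  qed
  moreover have "(k \<otimes> g) \<otimes> inv (c (k \<otimes> g)) = k \<otimes> (g \<otimes> inv (c g))" if k: "k \<in> K" and g: "g \<in> carrier G" for k g
  proof -
    have "K #> (k \<otimes> g) = K #> g"
      using coset_mult_assoc[OF K.subset _ g, of k] k coset_join2[OF _ K k] by simp
    then have "c (k \<otimes> g) = c g"
      by (simp add: c_def)
    then show ?thesis
      using k g cc[OF g] by (simp add: m_assoc)
  qed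
  ultimately show ?thesis
    by (intro exI[of _ "\<lambda>g. g \<otimes> inv (c g)"]) blast
qed

text \<open>Every generated element is the product of a finite word in generators and their
  inverses, and there are countably many words.\<close>

lemma countable_generate:
  assumes "X \<subseteq> carrier G" "countable X"
  shows "countable (generate G X)"
proof -
  let ?A = "X \<union> m_inv G ` X"
  have A: "?A \<subseteq> carrier G"
    using assms(1) by auto
  have app: "foldr (\<otimes>) us \<one> \<otimes> foldr (\<otimes>) vs \<one> = foldr (\<otimes>) (us @ vs) \<one>"
    if "set us \<subseteq> carrier G" "set vs \<subseteq> carrier G" for us vs
  proof -
    have cl: "foldr (\<otimes>) ws \<one> \<in> carrier G" if "set ws \<subseteq> carrier G" for ws
      using that by (induction ws) auto
    show "foldr (\<otimes>) us \<one> \<otimes> foldr (\<otimes>) vs \<one> = foldr (\<otimes>) (us @ vs) \<one>"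
      using that by (induction us) (auto simp: cl m_assoc)
  qed
  have "generate G X \<subseteq> (\<lambda>ws. foldr (\<otimes>) ws \<one>) ` lists ?A"
  proof
    fix g assume "g \<in> generate G X"
    then show "g \<in> (\<lambda>ws. foldr (\<otimes>) ws \<one>) ` lists ?A"
    proof (induction rule: generate.induct)
      case one
      show ?case by (rule image_eqI[of _ _ "[]"]) auto
    next
      case (incl h)
      then show ?case using A by (intro image_eqI[of _ _ "[h]"]) auto
    next
      case (inv h)
      then show ?case using A by (intro image_eqI[of _ _ "[inv h]"]) auto
    next
      case (eng g h)
      then obtain us vs where us: "us \<in> lists ?A" "g = foldr (\<otimes>) us \<one>"
        and vs: "vs \<in> lists ?A" "h = foldr (\<otimes>) vs \<one>"
        by (elim imageE) blast
      have "set us \<subseteq> carrier G" "set vs \<subseteq> carrier G"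
        using us(1) vs(1) A unfolding in_lists_conv_set by blast+
      then have "g \<otimes> h = foldr (\<otimes>) (us @ vs) \<one>"
        unfolding us(2) vs(2) by (rule app)
      moreover have "us @ vs \<in> lists ?A"
        using us(1) vs(1) by simp
      ultimately show ?case
        by (rule image_eqI)
    qed
  qed
  moreover have "countable (lists ?A)"
    using assms(2) by (intro countable_lists) auto
  ultimately show ?thesis
    by (rule countable_subset[OF _ countable_image])
qed

lemma exists_countable_subgroup:
  assumes L: "subgroup L G" and "infinite L"
  shows "\<exists>Z. subgroup Z G \<and> Z \<subseteq> L \<and> countable Z \<and> infinite Z"
proof -
  obtain X where X: "X \<subseteq> L" "countable X" "infinite X"
    using infinite_countable_subset'[OF assms(2)] by blast
  have Xc: "X \<subseteq> carrier G"
    using X(1) subgroup.subset[OF L] by blast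
  have "X \<subseteq> generate G X"
    by (auto intro: generate.incl)
  then show ?thesis
    using X generate_is_subgroup[OF Xc] generate_subgroup_incl[OF X(1) L] countable_generate[OF Xc X(2)]
    by (intro exI[of _ "generate G X"]) (auto dest: finite_subset)
qed

text \<open>Makes the finite sets {\<open>z i \<otimes> w n\<close> : i at most n} pairwise
  disjoint. At stage n only finitely many values of \<open>w n\<close> are forbidden, and Z is
  infinite.\<close>

lemma exists_separated_sequence:
  assumes Z: "subgroup Z G" "infinite Z" and z: "\<And>n::nat. z n \<in> Z"
  shows "\<exists>w::nat \<Rightarrow> 'a. \<forall>n. w n \<in> Z \<and> (\<forall>m<n. \<forall>i\<le>n. \<forall>j\<le>n. z i \<otimes> w n \<noteq> z j \<otimes> w m)"
proof (rule dependent_wellorder_choice)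
  fix n :: nat and w :: "nat \<Rightarrow> 'a"
  assume IH: "\<And>m. m < n \<Longrightarrow> w m \<in> Z \<and> (\<forall>l<m. \<forall>i\<le>m. \<forall>j\<le>m. z i \<otimes> w m \<noteq> z j \<otimes> w l)"
  have zc: "z i \<in> carrier G" for i
    using z subgroup.subset[OF Z(1)] by blast
  \<comment> \<open>The solutions r of \<open>z i \<otimes> r = z j \<otimes> w m\<close> over the
    finitely many admissible i, j, m.\<close>
  define B where "B = (\<lambda>(m, i, j). inv (z i) \<otimes> (z j \<otimes> w m)) ` ({..<n} \<times> {..n} \<times> {..n})"
  have "finite B"
    by (simp add: B_def)
  then obtain r where r: "r \<in> Z" "r \<notin> B"
    using Z(2) by (meson finite_subset subsetI)
  have rc: "r \<in> carrier G"
    using r(1) subgroup.subset[OF Z(1)] by blast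
  have "z i \<otimes> r \<noteq> z j \<otimes> w m" if "m < n" "i \<le> n" "j \<le> n" for m i j
  proof
    assume "z i \<otimes> r = z j \<otimes> w m"
    then have "r = inv (z i) \<otimes> (z j \<otimes> w m)"
      using rc zc[of i] by (metis inv_closed l_inv l_one m_assoc)
    then show False
      using r(2) that unfolding B_def by force
  qed
  then show "\<exists>r. r \<in> Z \<and> (\<forall>m<n. \<forall>i\<le>n. \<forall>j\<le>n. z i \<otimes> r \<noteq> z j \<otimes> w m)"
    using r(1) by blast
qed auto

text \<open>The fibres of \<open>\<zeta>\<close> are left translates of one another, so their
  indicators share one mean c. A sum of n of these indicators is bounded by 1 but has mean n c;
  boundedness of M for all n forces c = 0.\<close>

lemma mean_fibre_null:
  assumes M: "functional_on (carrier G) M"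
    and inv: "\<And>f s. bounded_fun (carrier G) f \<Longrightarrow> s \<in> carrier G \<Longrightarrow> M (\<lambda>t. f (s \<otimes> t)) = M f"
    and Z: "subgroup Z G" "infinite Z"
    and \<zeta>: "\<And>g. g \<in> carrier G \<Longrightarrow> \<zeta> g \<in> Z"
      "\<And>k g. k \<in> Z \<Longrightarrow> g \<in> carrier G \<Longrightarrow> \<zeta> (k \<otimes> g) = k \<otimes> \<zeta> g"
    and b: "b \<in> Z"
  shows "M (\<lambda>t. if \<zeta> t = b then 1 else 0) = 0"
proof -
  interpret Z: subgroup Z G by (rule Z(1))
  let ?e = "\<lambda>b t. if \<zeta> t = b then 1 else (0::complex)"
  define c where "c = M (?e \<one>)"
  have e: "M (?e b) = c" if b: "b \<in> Z" for b
  proof -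
    have bc: "b \<in> carrier G"
      using b by simp
    have "M (?e b) = M (\<lambda>t. ?e b (b \<otimes> t))"
      by (rule inv[OF bounded_fun_indicator bc, symmetric])
    also have "\<dots> = M (?e \<one>)"
    proof (rule functional_on_cong[OF M])
      fix t assume t: "t \<in> carrier G"
      then have "\<zeta> t \<in> carrier G"
        using \<zeta>(1) by simp
      then have "b \<otimes> \<zeta> t = b \<longleftrightarrow> \<zeta> t = \<one>"
        using bc by simp
      then show "?e b (b \<otimes> t) = ?e \<one> t"
        using \<zeta>(2)[OF b t] by simp
    qed
    finally show ?thesis
      by (simp add: c_def)
  qed
  obtain C where C: "0 \<le> C"
    "\<forall>f K. 0 \<le> K \<longrightarrow> (\<forall>x\<in>carrier G. cmod (f x) \<le> K) \<longrightarrow> cmod (M f) \<le> C * K"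
    using functional_on_bound[OF M] by blast
  have "real n * cmod c \<le> C" for n
  proof -
    obtain B where B: "B \<subseteq> Z" "finite B" "card B = n"
      using infinite_arbitrarily_large[OF Z(2)] by blast
    have "M (\<lambda>t. \<Sum>b\<in>B. ?e b t) = (\<Sum>b\<in>B. M (?e b))"
      by (rule functional_on_sum[OF M bounded_fun_indicator])
    also have "\<dots> = of_nat n * c"
      using e B by (simp add: subset_eq)
    finally have "real n * cmod c = cmod (M (\<lambda>t. \<Sum>b\<in>B. ?e b t))"
      by (simp add: norm_mult)
    also have "\<dots> \<le> C * 1"
      by (rule C(2)[rule_format]) (use B(2) in auto)
    finally show ?thesis by simp
  qed
  then have "cmod c = 0"
    by (metis (no_types, opaque_lifting) mult.commute norm_ge_zero order_le_less reals_Archimedean3 not_less)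
  then show ?thesis
    using e[OF b] by simp
qed

text \<open>With \<open>M\<close> an invariant mean, \<open>Z = {z\<^sub>0, z\<^sub>1, \<dots>}\<close> a countable subgroup and
  \<open>P = lim w\<^sub>2\<^sub>n\<close>, \<open>Q = lim w\<^sub>2\<^sub>n\<^sub>+\<^sub>1\<close> along a separated sequence, the difference
  is \<open>M P - M Q\<close>. It is nonzero on the indicator of a set that, in every left coset of \<open>Z\<close>,
  contains all \<open>z\<^sub>i w\<^sub>2\<^sub>n\<close> and no \<open>z\<^sub>i w\<^sub>2\<^sub>n\<^sub>+\<^sub>1\<close> with \<open>i \<le> n\<close>. The limits are taken by
  means of \<open>M\<close> itself, through a map \<open>\<nu>\<close> to the natural numbers all of whose fibres are null.\<close>

lemma exists_invariant_diff:
  assumes "amenable G" and L: "subgroup L G" "infinite L"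
  shows "\<exists>\<gamma> a. invariant_diff L \<gamma> \<and> bounded_fun L a \<and> \<gamma> a = 1"
proof -
  interpret L: subgroup L G by (rule L(1))
  obtain M where M: "functional_on (carrier G) M" and M1: "M (\<lambda>_. 1) = 1"
    and Minv: "\<And>f s. bounded_fun (carrier G) f \<Longrightarrow> s \<in> carrier G \<Longrightarrow> M (\<lambda>t. f (s \<otimes> t)) = M f"
    using amenable_imp_mean[OF assms(1)] by blast
  obtain Z where Z: "subgroup Z G" "Z \<subseteq> L" "countable Z" "infinite Z"
    using exists_countable_subgroup[OF L] by blast
  interpret Z: subgroup Z G by (rule Z(1))
  obtain \<pi> where \<pi>: "\<And>g. g \<in> carrier G \<Longrightarrow> \<pi> g \<in> L"
      "\<And>k g. k \<in> L \<Longrightarrow> g \<in> carrier G \<Longrightarrow> \<pi> (k \<otimes> g) = k \<otimes> \<pi> g"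
    using equivariant_retraction[OF L(1)] by blast
  obtain \<zeta> where \<zeta>: "\<And>g. g \<in> carrier G \<Longrightarrow> \<zeta> g \<in> Z"
      "\<And>k g. k \<in> Z \<Longrightarrow> g \<in> carrier G \<Longrightarrow> \<zeta> (k \<otimes> g) = k \<otimes> \<zeta> g"
    using equivariant_retraction[OF Z(1)] by blast
  define z where "z = from_nat_into Z"
  have z: "z n \<in> Z" for n
    unfolding z_def using Z(4) by (intro from_nat_into) auto
  define \<nu> where "\<nu> t = to_nat_on Z (\<zeta> t)" for t
  have z\<nu>: "\<zeta> t = z n \<longleftrightarrow> \<nu> t = n" if "t \<in> carrier G" for t n
    using \<zeta>(1)[OF that] Z(3,4) unfolding z_def \<nu>_def by auto
  have z_surj: "\<exists>i. x = z i" if "x \<in> Z" for x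
    using from_nat_into_surj[OF Z(3) that] by (auto simp: z_def)
  obtain w where w': "\<forall>n. w n \<in> Z \<and> (\<forall>m<n. \<forall>i\<le>n. \<forall>j\<le>n. z i \<otimes> w n \<noteq> z j \<otimes> w m)"
    using exists_separated_sequence[of Z z] Z(1,4) z by auto
  then have w: "w n \<in> Z" for n
    by simp
  have sep: "z i \<otimes> w n \<noteq> z j \<otimes> w m" if "m < n" "i \<le> n" "j \<le> n" for m n i j
    using w' that by simp
  have wL: "w n \<in> L" for n
    using w Z(2) by blast
  \<comment> \<open>A function of \<open>\<nu> t\<close> that is eventually c differs from the
    constant c only on finitely many null fibres. Thus M acts as a limit along
    \<open>\<nu>\<close>.\<close>
  have lim: "M (\<lambda>t. h (\<nu> t)) = c" if "\<And>n. n \<ge> N \<Longrightarrow> h n = c" for h :: "nat \<Rightarrow> complex" and N c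
  proof -
    have "M (\<lambda>t. h (\<nu> t)) = M (\<lambda>t. c * 1 + (\<Sum>n<N. (h n - c) * (if \<zeta> t = z n then 1 else 0)))"
      by (rule functional_on_cong[OF M]) (simp add: z\<nu> that mult_delta_right not_less)
    also have "\<dots> = c * M (\<lambda>_. 1) + (\<Sum>n<N. (h n - c) * M (\<lambda>t. if \<zeta> t = z n then 1 else 0))"
      by (simp only: functional_on_add[OF M] functional_on_sum[OF M] functional_on_scale[OF M]
          bounded_fun_const bounded_fun_sum bounded_fun_mult bounded_fun_indicator)
    also have "\<dots> = c"
      using mean_fibre_null[OF M Minv Z(1,4) \<zeta> z] by (simp add: M1)
    finally show ?thesis .
  qed
  define A where "A = {z i \<otimes> w (2 * n) |i n. i \<le> n}"
  \<comment> \<open>Inversion turns the left equivariant \<open>\<zeta>\<close> into a right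
    equivariant map. It reads off a Z-coordinate in each left coset of Z, so that a subset of Z
    defines a function on all of L.\<close>
  define \<rho> where "\<rho> g = inv (\<zeta> (inv g))" for g
  have \<rho>: "\<rho> g \<in> Z" "k \<in> Z \<Longrightarrow> \<rho> (g \<otimes> k) = \<rho> g \<otimes> k" if "g \<in> carrier G" for g k
    using that \<zeta>(1)[of "inv g"] by (simp_all add: \<rho>_def inv_mult_group \<zeta>(2))
  define a where "a g = (if \<rho> g \<in> A then 1 else 0 :: complex)" for g
  \<comment> \<open>The inner mean is the limit over n of f at
    \<open>\<pi> s \<otimes> w (2 * n + e)\<close>; e = 0 or 1 selects the even or the odd
    subsequence. The outer mean averages over s and, \<open>\<pi>\<close> being equivariant,
    supplies left invariance.\<close>
  define \<phi> where "\<phi> e f = M (\<lambda>s. M (\<lambda>t. f (\<pi> s \<otimes> w (2 * \<nu> t + e))))" for e f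
  have \<phi>: "functional_on L (\<phi> e)" for e
    unfolding \<phi>_def by (rule functional_on_iterate[OF M M]) (simp add: \<pi> wL)
  have \<phi>inv: "\<phi> e (\<lambda>t. f (s \<otimes> t)) = \<phi> e f" if f: "bounded_fun L f" and s: "s \<in> L" for e f s
  proof -
    let ?g = "\<lambda>s. M (\<lambda>t. f (\<pi> s \<otimes> w (2 * \<nu> t + e)))"
    have "bounded_fun (carrier G) ?g"
      by (rule bounded_fun_apply[OF M f]) (simp add: \<pi> wL)
    then have "M (\<lambda>r. ?g (s \<otimes> r)) = M ?g"
      using s by (intro Minv) auto
    moreover have "M (\<lambda>r. ?g (s \<otimes> r)) = \<phi> e (\<lambda>t. f (s \<otimes> t))"
      unfolding \<phi>_def
    proof (intro functional_on_cong[OF M])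
      fix r t assume r: "r \<in> carrier G"
      have "\<pi> r \<in> carrier G" "w (2 * \<nu> t + e) \<in> carrier G"
        using \<pi>(1)[OF r] wL by auto
      then show "f (\<pi> (s \<otimes> r) \<otimes> w (2 * \<nu> t + e)) = f (s \<otimes> (\<pi> r \<otimes> w (2 * \<nu> t + e)))"
        using s by (simp add: \<pi>(2)[OF s r] m_assoc)
    qed
    ultimately show ?thesis
      by (simp add: \<phi>_def)
  qed
  have \<phi>a: "\<phi> e a = c" if c: "\<And>i n. i \<le> n \<Longrightarrow> (if z i \<otimes> w (2 * n + e) \<in> A then 1 else 0) = c" for e c
  proof -
    have "M (\<lambda>t. a (\<pi> s \<otimes> w (2 * \<nu> t + e))) = c" if s: "s \<in> carrier G" for s
    proof -
      have ps: "\<pi> s \<in> carrier G"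
        using \<pi>(1)[OF s] by auto
      \<comment> \<open>With s fixed, the Z-coordinate of \<open>\<pi> s\<close> is some
        \<open>z i\<close>, and the hypothesis on c applies from n = i onwards. The inner limit is
        therefore c for every s.\<close>
      obtain i where "\<rho> (\<pi> s) = z i"
        using z_surj[OF \<rho>(1)[OF ps]] by blast
      then show ?thesis
        using c by (intro lim[where N = i]) (simp add: a_def \<rho>(2)[OF ps w])
    qed
    then have "\<phi> e a = M (\<lambda>_. c)"
      unfolding \<phi>_def by (intro functional_on_cong[OF M]) simp
    then show ?thesis
      using functional_on_const[OF M, of c] M1 by simp
  qed
  have \<phi>1: "\<phi> e (\<lambda>_. 1) = 1" for e
    by (simp add: \<phi>_def M1)
  have "\<phi> 0 a = 1"
    by (rule \<phi>a) (auto simp: A_def)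
  moreover have "\<phi> 1 a = 0"
  proof (rule \<phi>a)
    fix i n :: nat assume i: "i \<le> n"
    \<comment> \<open>The indices 2 m and 2 n + 1 have different parity, so one is strictly larger.
      Separation bounds i and j by that larger index, and i at most n, j at most m satisfy this in
      both cases.\<close>
    have "z i \<otimes> w (2 * n + 1) \<noteq> z j \<otimes> w (2 * m)" if "j \<le> m" for j m
      using sep[of "2 * m" "2 * n + 1" i j] sep[of "2 * n + 1" "2 * m" j i] i that
      by (cases "m \<le> n") auto
    then show "(if z i \<otimes> w (2 * n + 1) \<in> A then 1 else 0) = (0::complex)"
      by (auto simp: A_def)
  qed
  moreover have "invariant_diff L (\<lambda>f. \<phi> 0 f - \<phi> 1 f)"
    unfolding invariant_diff_def
    using \<phi>1 by (intro conjI functional_on_diff \<phi>) (simp_all add: \<phi>inv)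
  moreover have "bounded_fun L a"
    unfolding a_def by (rule bounded_fun_indicator)
  ultimately show ?thesis
    by (intro exI[of _ "\<lambda>f. \<phi> 0 f - \<phi> 1 f"] exI[of _ a]) simp
qed

end

section \<open>Invariant differences of subnormal subgroups\<close>

lemma ell1_subgroup_subset:
  assumes "L \<subseteq> carrier G"
  shows "ell1 (G\<lparr>carrier := L\<rparr>) \<subseteq> ell1 G"
proof
  fix a assume a: "a \<in> ell1 (G\<lparr>carrier := L\<rparr>)"
  then have "(\<lambda>x. cmod (a x)) summable_on L" "\<forall>x. x \<notin> L \<longrightarrow> a x = 0"
    by (auto simp: ell1_def)
  moreover from this have "(\<lambda>x. cmod (a x)) summable_on carrier G"
    using summable_on_cong_neutral[of "carrier G" L "\<lambda>x. cmod (a x)" "\<lambda>x. cmod (a x)"] assms by auto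
  ultimately show "a \<in> ell1 G"
    using assms by (auto simp: ell1_def)
qed

lemma linf_functional_subgroup:
  assumes "L \<subseteq> carrier G" "a \<in> ell1 (G\<lparr>carrier := L\<rparr>)"
  shows "linf_functional G f a = linf_functional (G\<lparr>carrier := L\<rparr>) f a"
proof -
  have "(\<Sum>\<^sub>\<infinity>x\<in>carrier G. a x * f x) = (\<Sum>\<^sub>\<infinity>x\<in>L. a x * f x)"
    by (rule infsum_cong_neutral) (use assms ell1_outside[OF assms(2)] in auto)
  then show ?thesis
    using assms ell1_subgroup_subset[OF assms(1)] by (auto simp: linf_functional_def)
qed

text \<open>The inner adjoint restricts u to the group algebra of L, which leaves its values at
  point masses of L unchanged, and \<open>\<gamma>\<close> looks at nothing else. Hence the
  inclusion of biduals is the identity on underlying functionals.\<close>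

lemma bidual_incl_of_functional:
  assumes L: "L \<subseteq> carrier G" and \<gamma>: "functional_on L \<gamma>"
  shows "bidual_incl G L (of_functional (G\<lparr>carrier := L\<rparr>) \<gamma>) = of_functional G \<gamma>"
proof
  let ?K = "G\<lparr>carrier := L\<rparr>"
  fix u
  show "bidual_incl G L (of_functional ?K \<gamma>) u = of_functional G \<gamma> u"
  proof (cases "u \<in> ell1_dual G")
    case u: True
    let ?f = "\<lambda>x. u (point_mass x)"
    have f: "bounded_fun (carrier ?K) ?f"
      using dual_point_mass_bounded[OF u] L unfolding bounded_fun_def by auto
    have "adjoint_map (ell1 ?K) (\<lambda>f. f) u = linf_functional ?K ?f"
    proof
      fix a
      show "adjoint_map (ell1 ?K) (\<lambda>f. f) u a = linf_functional ?K ?f a"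
        using dual_eq_linf_functional[OF u] linf_functional_subgroup[OF L, of a ?f]
        by (cases "a \<in> ell1 ?K") (simp_all add: adjoint_map_def linf_functional_def[of ?K])
    qed
    then have "bidual_incl G L (of_functional ?K \<gamma>) u = pairing ?K (of_functional ?K \<gamma>) ?f"
      using u by (simp add: bidual_incl_def adjoint_map_def[of "ell1_dual G"] pairing_def)
    also have "\<dots> = \<gamma> ?f"
      using \<gamma> f by (intro pairing_of_functional) simp_all
    finally show ?thesis
      using u by (simp add: of_functional_def)
  qed (simp add: bidual_incl_def adjoint_map_def of_functional_def)
qed

interpretation bidual_module: module "\<lambda>(c :: complex) (\<Phi> :: 'a bidual_elem) u. c * \<Phi> u"
  by unfold_locales (auto simp: algebra_simps)

context group
begin

lemma of_functional_invariant_diff: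
  assumes L: "subgroup L G" "subnormal L G" and \<gamma>: "invariant_diff L \<gamma>"
  shows "of_functional G \<gamma> \<in> sn_differences G"
proof -
  let ?K = "G\<lparr>carrier := L\<rparr>"
  interpret L: subgroup L G by (rule L(1))
  interpret K: group ?K by (rule L.subgroup_is_group[OF group_axioms])
  have f\<gamma>: "functional_on (carrier ?K) \<gamma>" and one: "\<gamma> (\<lambda>_. 1) = 0"
    and inv: "\<And>f s. bounded_fun L f \<Longrightarrow> s \<in> L \<Longrightarrow> \<gamma> (\<lambda>t. f (s \<otimes> t)) = \<gamma> f"
    using \<gamma> by (auto simp: invariant_diff_def)
  let ?\<Gamma> = "of_functional ?K \<gamma>"
  note \<Gamma> = of_functional_bidual[OF f\<gamma>]
  have "arens ?K (delta ?K s) ?\<Gamma> = ?\<Gamma>" if s: "s \<in> carrier ?K" for s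
  proof (rule pairing_eqI)
    fix f :: "'a \<Rightarrow> complex" assume f: "bounded_fun (carrier ?K) f"
    have "pairing ?K (arens ?K (delta ?K s) ?\<Gamma>) f = pairing ?K ?\<Gamma> (\<lambda>t. f (s \<otimes> t))"
      using K.bounded_fun_pairing[OF \<Gamma> f] s
      by (simp add: K.pairing_arens[OF \<Gamma> f] K.pairing_delta)
    also have "\<dots> = \<gamma> (\<lambda>t. f (s \<otimes> t))"
      using K.bounded_fun_translate[OF f s] by (simp add: pairing_of_functional[OF f\<gamma>])
    also have "\<dots> = pairing ?K ?\<Gamma> f"
      using inv f s by (simp add: pairing_of_functional[OF f\<gamma> f])
    finally show "pairing ?K (arens ?K (delta ?K s) ?\<Gamma>) f = pairing ?K ?\<Gamma> f" .
  qed (intro K.arens_bidual K.delta_bidual s \<Gamma>)+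
  moreover have "?\<Gamma> (linf_functional ?K (\<lambda>_. 1)) = 0"
    using pairing_of_functional[OF f\<gamma> bounded_fun_const[of _ 1]] one by (simp add: pairing_def)
  ultimately have "?\<Gamma> \<in> invariant_differences ?K"
    using \<Gamma> by (simp add: invariant_differences_def)
  moreover have "of_functional G \<gamma> = bidual_incl G L ?\<Gamma>"
    using f\<gamma> by (simp add: bidual_incl_of_functional L.subset)
  ultimately show ?thesis
    using L(2) by (auto simp: sn_differences_def)
qed

lemma sum_sn_differences_in_A_sn:
  assumes "\<And>j. j \<in> J \<Longrightarrow> \<Gamma> j \<in> sn_differences G"
  shows "(\<Sum>j\<in>J. \<Gamma> j) \<in> A_sn G"
  unfolding A_sn_def bidual_span_def
proof (intro bidual_module.span_sum bidual_module.span_base)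
  fix j assume "j \<in> J"
  then show "\<Gamma> j \<in> {foldr (arens G) (butlast \<Gamma>s) (last \<Gamma>s) |\<Gamma>s. \<Gamma>s \<noteq> [] \<and> set \<Gamma>s \<subseteq> sn_differences G}"
    using assms by (intro CollectI exI[of _ "[\<Gamma> j]"]) simp
qed

lemma sum_sn_differences_in_J_sn:
  assumes "\<And>j. j \<in> J \<Longrightarrow> \<Gamma> j \<in> sn_differences G \<inter> ell1_bidual G"
  shows "(\<Sum>j\<in>J. \<Gamma> j) \<in> J_sn G"
  unfolding J_sn_def bidual_span_def
proof (intro bidual_module.span_sum bidual_module.span_base)
  fix j assume j: "j \<in> J"
  interpret R: ring "bidual_ring G" by (rule ring_bidual_ring)
  have "\<Gamma> j = arens G (delta G \<one>) (\<Gamma> j)"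
    using R.l_one[of "\<Gamma> j"] assms[OF j] by (simp add: bidual_ring_simps)
  then show "\<Gamma> j \<in> {arens G \<Phi> \<Gamma> |\<Phi> \<Gamma>. \<Phi> \<in> ell1_bidual G \<and> \<Gamma> \<in> sn_differences G}"
    using assms[OF j] delta_bidual by blast
qed

lemma sum_bidual:
  assumes "\<And>j. j \<in> J \<Longrightarrow> \<Gamma> j \<in> ell1_bidual G"
  shows "(\<Sum>j\<in>J. \<Gamma> j) \<in> ell1_bidual G"
  using assms
proof (induction J rule: infinite_finite_induct)
  case (insert j J)
  then show ?case
    using ell1_bidual_add[of "\<Gamma> j" "\<Sum>j\<in>J. \<Gamma> j"] by (simp add: plus_fun_def)
qed (use ell1_bidual_zero in \<open>simp_all add: zero_fun_def\<close>)

lemma pairing_sum: "pairing G (\<Sum>j\<in>J. \<Gamma> j) f = (\<Sum>j\<in>J. pairing G (\<Gamma> j) f)"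
  by (induction J rule: infinite_finite_induct) (simp_all add: pairing_def)

section \<open>A filtration by right invariance\<close>

definition right_invariant :: "'a set set \<Rightarrow> ('a \<Rightarrow> complex) \<Rightarrow> bool"
  where "right_invariant S f \<longleftrightarrow> (\<forall>K\<in>S. \<forall>s\<in>carrier G. \<forall>l\<in>K. f (s \<otimes> l) = f s)"

definition conjugate_set :: "'a \<Rightarrow> 'a set \<Rightarrow> 'a set"
  where "conjugate_set g K = (\<lambda>h. g \<otimes> h \<otimes> inv g) ` K"

text \<open>Conjugation by g is undone by conjugation by its inverse. This ensures that conjugating
  a family of subgroups preserves its cardinality.\<close>

lemma inj_on_conjugate_set:
  assumes "g \<in> carrier G" "\<And>K. K \<in> S \<Longrightarrow> K \<subseteq> carrier G"
  shows "inj_on (conjugate_set g) S"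
proof (rule inj_onI)
  have *: "(\<lambda>h. inv g \<otimes> h \<otimes> g) ` conjugate_set g K = K" if "K \<subseteq> carrier G" for K
  proof -
    have "inv g \<otimes> (g \<otimes> h \<otimes> inv g) \<otimes> g = h" if "h \<in> K" for h
      using assms(1) subsetD[OF \<open>K \<subseteq> carrier G\<close> that]
      by (simp add: m_assoc[symmetric]) (simp add: m_assoc)
    then have "(\<lambda>h. inv g \<otimes> h \<otimes> g) ` conjugate_set g K = (\<lambda>h. h) ` K"
      unfolding conjugate_set_def image_image by (intro image_cong) simp_all
    then show ?thesis by simp
  qed
  fix K K' assume "K \<in> S" "K' \<in> S" "conjugate_set g K = conjugate_set g K'"
  then show "K = K'"
    using *[OF assms(2)] by metis
qed

inductive_set filtration :: "'a set set \<Rightarrow> nat \<Rightarrow> ('a \<Rightarrow> complex) set"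
  for C :: "'a set set" and m :: nat
  where
    base: "S \<subseteq> C \<Longrightarrow> card S = m \<Longrightarrow> bounded_fun (carrier G) f \<Longrightarrow> right_invariant S f \<Longrightarrow> f \<in> filtration C m"
  | zero: "(\<lambda>_. 0) \<in> filtration C m"
  | add: "f \<in> filtration C m \<Longrightarrow> g \<in> filtration C m \<Longrightarrow> (\<lambda>x. f x + g x) \<in> filtration C m"
  | agree: "f \<in> filtration C m \<Longrightarrow> \<forall>x\<in>carrier G. f x = g x \<Longrightarrow> g \<in> filtration C m"

lemma filtration_sum:
  "(\<And>i. i \<in> I \<Longrightarrow> f i \<in> filtration C m) \<Longrightarrow> (\<lambda>x. \<Sum>i\<in>I. f i x) \<in> filtration C m"
  by (induction I rule: infinite_finite_induct) (auto intro: filtration.zero filtration.add)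

lemma filtration_bounded: "f \<in> filtration C m \<Longrightarrow> bounded_fun (carrier G) f"
proof (induction rule: filtration.induct)
  case (agree f g)
  then show ?case by (simp add: bounded_fun_def)
qed (auto intro: bounded_fun_add)

lemma filtration_vanishes:
  assumes "f \<in> filtration C m" "finite C" "card C < m" "x \<in> carrier G"
  shows "f x = 0"
  using assms
proof (induction rule: filtration.induct)
  case (base S f)
  then show ?case
    using card_mono[of C S] by simp
qed auto

text \<open>The functional is cut into pieces according to the image \<open>t S t\<inverse>\<close> of \<open>S\<close>;
  the piece belonging to \<open>S'\<close> turns invariance under \<open>S\<close> into invariance under \<open>S'\<close>.\<close>

lemma filtration_act:
  assumes f: "f \<in> filtration C m" and C: "finite C" "\<And>K. K \<in> C \<Longrightarrow> K \<subseteq> carrier G"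
    and conj: "\<And>g K. g \<in> carrier G \<Longrightarrow> K \<in> C \<Longrightarrow> conjugate_set g K \<in> C"
    and \<psi>: "functional_on (carrier G) \<psi>"
  shows "(\<lambda>s. \<psi> (\<lambda>t. f (s \<otimes> t))) \<in> filtration C m"
  using f
proof (induction rule: filtration.induct)
  case (base S f)
  have fin: "finite (Pow C)"
    using C(1) by simp
  let ?D = "{S' \<in> Pow C. card S' = m}"
  define h where "h S' s = \<psi> (\<lambda>t. if conjugate_set t ` S = S' then f (s \<otimes> t) else 0)" for S' s
  \<comment> \<open>Each t thus falls into exactly one of the finitely many pieces, so the pieces
    add up to the original functional.\<close>
  have img: "conjugate_set t ` S \<in> ?D" if t: "t \<in> carrier G" for t
  proof -
    have "inj_on (conjugate_set t) S"
      using base(1) C(2) by (intro inj_on_conjugate_set t) blast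
    then show ?thesis
      using base(1,2) conj[OF t] by (auto simp: card_image)
  qed
  have piece: "bounded_fun (carrier G) (\<lambda>t. if conjugate_set t ` S = S' then f (s \<otimes> t) else 0)"
    if "s \<in> carrier G" for s S'
    by (intro bounded_fun_if bounded_fun_translate base that)
  have "h S' \<in> filtration C m" if S': "S' \<in> ?D" for S'
  proof (rule filtration.base)
    show "S' \<subseteq> C" "card S' = m"
      using S' by auto
    obtain K where K: "0 \<le> K" "\<forall>x\<in>carrier G. cmod (f x) \<le> K"
      using bounded_funD[OF base(3)] by blast
    obtain B where B: "0 \<le> B"
      "\<forall>f K. 0 \<le> K \<longrightarrow> (\<forall>x\<in>carrier G. cmod (f x) \<le> K) \<longrightarrow> cmod (\<psi> f) \<le> B * K"
      using functional_on_bound[OF \<psi>] by blast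
    show "bounded_fun (carrier G) (h S')"
    proof (rule bounded_funI)
      fix s assume "s \<in> carrier G"
      then show "cmod (h S' s) \<le> B * K"
        unfolding h_def using K by (intro B(2)[rule_format]) simp_all
    qed
    show "right_invariant S' (h S')"
      unfolding right_invariant_def
    proof (intro ballI)
      fix K' s l assume K': "K' \<in> S'" and s: "s \<in> carrier G" and l: "l \<in> K'"
      have lc: "l \<in> carrier G"
        using K' l S' C(2) by blast
      show "h S' (s \<otimes> l) = h S' s"
        unfolding h_def
      proof (rule functional_on_cong[OF \<psi>])
        fix t assume t: "t \<in> carrier G"
        have "f (s \<otimes> l \<otimes> t) = f (s \<otimes> t)" if im: "conjugate_set t ` S = S'"
        proof -
          obtain K where K: "K \<in> S" "K' = conjugate_set t K"
            using K' im by blast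
          then obtain k where k: "k \<in> K" "l = t \<otimes> k \<otimes> inv t"
            using l by (auto simp: conjugate_set_def)
          have kc: "k \<in> carrier G"
            using K(1) k(1) base(1) C(2) by blast
          \<comment> \<open>The conjugate l of k becomes k itself on being moved past t, where the
            invariance of f under K absorbs it.\<close>
          have "s \<otimes> l \<otimes> t = s \<otimes> t \<otimes> k"
            using s t kc by (simp add: k(2) m_assoc)
          then show ?thesis
            using base(4) K(1) k(1) s t by (simp add: right_invariant_def)
        qed
        then show "(if conjugate_set t ` S = S' then f (s \<otimes> l \<otimes> t) else 0)
            = (if conjugate_set t ` S = S' then f (s \<otimes> t) else 0)"
          by simp
      qed
    qed
  qed
  then have sum: "(\<lambda>s. \<Sum>S'\<in>?D. h S' s) \<in> filtration C m"
    by (rule filtration_sum)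
  have "(\<Sum>S'\<in>?D. h S' s) = \<psi> (\<lambda>t. f (s \<otimes> t))" if s: "s \<in> carrier G" for s
  proof -
    have "(\<Sum>S'\<in>?D. h S' s)
        = \<psi> (\<lambda>t. \<Sum>S'\<in>?D. if conjugate_set t ` S = S' then f (s \<otimes> t) else 0)"
      unfolding h_def by (rule functional_on_sum[OF \<psi> piece[OF s], symmetric])
    also have "\<dots> = \<psi> (\<lambda>t. f (s \<otimes> t))"
    proof (rule functional_on_cong[OF \<psi>])
      fix t assume "t \<in> carrier G"
      then show "(\<Sum>S'\<in>?D. if conjugate_set t ` S = S' then f (s \<otimes> t) else 0) = f (s \<otimes> t)"
        using img[of t] fin by (simp add: sum.delta)
    qed
    finally show ?thesis .
  qed
  then show ?case
    by (intro filtration.agree[OF sum]) simp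
next
  case zero
  then show ?case
    using filtration.zero by (simp add: functional_on_zero[OF \<psi>])
next
  case (add f g)
  have "\<psi> (\<lambda>t. f (s \<otimes> t)) + \<psi> (\<lambda>t. g (s \<otimes> t)) = \<psi> (\<lambda>t. f (s \<otimes> t) + g (s \<otimes> t))"
    if "s \<in> carrier G" for s
    by (intro functional_on_add[OF \<psi>, symmetric] bounded_fun_translate
        filtration_bounded[OF add.hyps(1)] filtration_bounded[OF add.hyps(2)] that)
  then show ?case
    by (intro filtration.agree[OF filtration.add[OF add.IH]]) simp
next
  case (agree f g)
  have "\<psi> (\<lambda>t. f (s \<otimes> t)) = \<psi> (\<lambda>t. g (s \<otimes> t))" if "s \<in> carrier G" for s
    using that agree.hyps by (intro functional_on_cong[OF \<psi>]) simp
  then show ?case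
    by (intro filtration.agree[OF agree.IH]) simp
qed

text \<open>Invariance under K is gained from the left invariance of \<open>\<gamma>\<close> on K.
  Invariance under the members of S persists because l t = t (t^-1 l t) and K normalises every
  member of C. If K already belongs to S, then t |-> f(s t) is constant on K and
  \<open>\<gamma>\<close> annihilates it.\<close>

lemma filtration_raise:
  assumes f: "f \<in> filtration C m" and C: "finite C" "\<And>K. K \<in> C \<Longrightarrow> K \<subseteq> carrier G"
    and K: "K \<in> C" "subgroup K G"
    and normalises: "\<And>t K' l. t \<in> K \<Longrightarrow> K' \<in> C \<Longrightarrow> l \<in> K' \<Longrightarrow> inv t \<otimes> l \<otimes> t \<in> K'"
    and \<gamma>: "invariant_diff K \<gamma>"
  shows "(\<lambda>s. \<gamma> (\<lambda>t. f (s \<otimes> t))) \<in> filtration C (Suc m)"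
  using f
proof (induction rule: filtration.induct)
  have f\<gamma>: "functional_on K \<gamma>" and one: "\<gamma> (\<lambda>_. 1) = 0"
    and inv: "\<And>f s. bounded_fun K f \<Longrightarrow> s \<in> K \<Longrightarrow> \<gamma> (\<lambda>t. f (s \<otimes> t)) = \<gamma> f"
    using \<gamma> by (auto simp: invariant_diff_def)
  have Kc: "x \<in> carrier G" if "x \<in> K" for x
    using that C(2)[OF K(1)] by blast
  have tr: "bounded_fun K (\<lambda>t. f (s \<otimes> t))" if "bounded_fun (carrier G) f" "s \<in> carrier G"
    for f :: "'a \<Rightarrow> complex" and s
    by (rule bounded_fun_compose[OF that(1)]) (simp add: that(2) Kc)
  {
    case (base S f)
    show ?case
    proof (cases "K \<in> S")
      case True
      have "\<gamma> (\<lambda>t. f (s \<otimes> t)) = 0" if s: "s \<in> carrier G" for s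
      proof -
        have "\<gamma> (\<lambda>t. f (s \<otimes> t)) = \<gamma> (\<lambda>_. f s)"
          using base(4) True s by (intro functional_on_cong[OF f\<gamma>]) (simp add: right_invariant_def)
        then show ?thesis
          using functional_on_const[OF f\<gamma>, of "f s"] one by simp
      qed
      then show ?thesis
        by (intro filtration.agree[OF filtration.zero]) simp
    next
      case False
      show ?thesis
      proof (rule filtration.base)
        show "insert K S \<subseteq> C"
          using base(1) K(1) by simp
        have "finite S"
          using base(1) C(1) by (rule finite_subset)
        then show "card (insert K S) = Suc m"
          using False base(2) by simp
        show "bounded_fun (carrier G) (\<lambda>s. \<gamma> (\<lambda>t. f (s \<otimes> t)))"
          by (rule bounded_fun_apply[OF f\<gamma> base(3)]) (simp add: Kc)
        show "right_invariant (insert K S) (\<lambda>s. \<gamma> (\<lambda>t. f (s \<otimes> t)))"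
          unfolding right_invariant_def
        proof (intro ballI)
          fix K' s l assume K': "K' \<in> insert K S" and s: "s \<in> carrier G" and l: "l \<in> K'"
          have lc: "l \<in> carrier G"
            using K' l K(1) base(1) C(2) by blast
          show "\<gamma> (\<lambda>t. f (s \<otimes> l \<otimes> t)) = \<gamma> (\<lambda>t. f (s \<otimes> t))"
          proof (cases "K' = K")
            case True
            have "\<gamma> (\<lambda>t. f (s \<otimes> l \<otimes> t)) = \<gamma> (\<lambda>t. f (s \<otimes> (l \<otimes> t)))"
              using s lc Kc by (intro functional_on_cong[OF f\<gamma>]) (simp add: m_assoc)
            also have "\<dots> = \<gamma> (\<lambda>t. f (s \<otimes> t))"
              using inv[OF tr[OF base(3) s]] l True by simp
            finally show ?thesis .
          next
            case False
            then have KS: "K' \<in> S"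
              using K' by simp
            show ?thesis
            proof (rule functional_on_cong[OF f\<gamma>])
              fix t assume t: "t \<in> K"
              have "s \<otimes> l \<otimes> t = (s \<otimes> t) \<otimes> (inv t \<otimes> l \<otimes> t)"
                using s lc Kc[OF t] by (simp add: m_assoc[symmetric]) (simp add: m_assoc)
              moreover have "inv t \<otimes> l \<otimes> t \<in> K'"
                using normalises[OF t _ l] KS base(1) by blast
              ultimately show "f (s \<otimes> l \<otimes> t) = f (s \<otimes> t)"
                using base(4) KS s Kc[OF t] by (simp add: right_invariant_def)
            qed
          qed
        qed
      qed
    qed
  next
    case zero
    then show ?case
      using filtration.zero by (simp add: functional_on_zero[OF f\<gamma>])
  next
    case (add f g)
    have "\<gamma> (\<lambda>t. f (s \<otimes> t)) + \<gamma> (\<lambda>t. g (s \<otimes> t)) = \<gamma> (\<lambda>t. f (s \<otimes> t) + g (s \<otimes> t))"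
      if "s \<in> carrier G" for s
      by (intro functional_on_add[OF f\<gamma>, symmetric] tr filtration_bounded[OF add.hyps(1)]
          filtration_bounded[OF add.hyps(2)] that)
    then show ?case
      by (intro filtration.agree[OF filtration.add[OF add.IH]]) simp
  next
    case (agree f g)
    have "\<gamma> (\<lambda>t. f (s \<otimes> t)) = \<gamma> (\<lambda>t. g (s \<otimes> t))" if "s \<in> carrier G" for s
      using that agree.hyps by (intro functional_on_cong[OF f\<gamma>]) (simp add: Kc)
    then show ?case
      by (intro filtration.agree[OF agree.IH]) simp
  }
qed

text \<open>In the product, \<open>\<Phi>\<close> acts first and raises the level, and
  \<open>\<Psi>\<close> then keeps it by \<open>filtration_act\<close>. So each power gains one
  level, and no nonzero level lies above \<open>card C\<close>.\<close>

lemma filtration_nilpotent: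
  assumes C: "finite C" "\<And>K. K \<in> C \<Longrightarrow> K \<subseteq> carrier G"
    and conj: "\<And>g K. g \<in> carrier G \<Longrightarrow> K \<in> C \<Longrightarrow> conjugate_set g K \<in> C"
    and \<Phi>: "\<Phi> \<in> ell1_bidual G" and \<Psi>: "\<Psi> \<in> ell1_bidual G"
    and raise: "\<And>f m. f \<in> filtration C m \<Longrightarrow> (\<lambda>s. pairing G \<Phi> (\<lambda>t. f (s \<otimes> t))) \<in> filtration C (Suc m)"
  shows "arens G \<Psi> \<Phi> [^]\<^bsub>bidual_ring G\<^esub> Suc (card C) = (\<lambda>_. 0)"
proof -
  interpret R: ring "bidual_ring G" by (rule ring_bidual_ring)
  define x where "x = arens G \<Psi> \<Phi>"
  have x: "x \<in> ell1_bidual G"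
    unfolding x_def by (rule arens_bidual[OF \<Psi> \<Phi>])
  have pow: "x [^]\<^bsub>bidual_ring G\<^esub> (n::nat) \<in> ell1_bidual G" for n
    using R.nat_pow_closed[of x n] x by (simp add: bidual_ring_simps)
  \<comment> \<open>Stated for every level m so that the induction can trade one power of x for one
    level.\<close>
  have *: "pairing G (x [^]\<^bsub>bidual_ring G\<^esub> n) f = 0" if "f \<in> filtration C m" "card C < m + n" for n m f
    using that
  proof (induction n arbitrary: f m)
    case 0
    then show ?case
      using filtration_vanishes[OF 0(1) C(1)] filtration_bounded[OF 0(1)]
      by (simp add: bidual_ring_simps pairing_delta)
  next
    case (Suc n)
    have f: "bounded_fun (carrier G) f"
      by (rule filtration_bounded[OF Suc.prems(1)])
    let ?g = "\<lambda>s. pairing G \<Phi> (\<lambda>t. f (s \<otimes> t))"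
    have "pairing G (x [^]\<^bsub>bidual_ring G\<^esub> Suc n) f
        = pairing G (x [^]\<^bsub>bidual_ring G\<^esub> n) (\<lambda>s. pairing G x (\<lambda>t. f (s \<otimes> t)))"
      using pairing_arens[OF x f] by (simp add: bidual_ring_simps)
    also have "\<dots> = pairing G (x [^]\<^bsub>bidual_ring G\<^esub> n) (\<lambda>s. pairing G \<Psi> (\<lambda>r. ?g (s \<otimes> r)))"
    proof (rule functional_on_cong[OF functional_on_pairing[OF pow]])
      fix s assume s: "s \<in> carrier G"
      have "pairing G x (\<lambda>t. f (s \<otimes> t)) = pairing G \<Psi> (\<lambda>r. pairing G \<Phi> (\<lambda>t. f (s \<otimes> (r \<otimes> t))))"
        unfolding x_def by (rule pairing_arens[OF \<Phi> bounded_fun_translate[OF f s]])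
      also have "\<dots> = pairing G \<Psi> (\<lambda>r. ?g (s \<otimes> r))"
        using s by (intro functional_on_cong[OF functional_on_pairing] \<Phi> \<Psi>) (simp add: m_assoc)
      finally show "pairing G x (\<lambda>t. f (s \<otimes> t)) = pairing G \<Psi> (\<lambda>r. ?g (s \<otimes> r))" .
    qed
    also have "\<dots> = 0"
      using Suc.prems
      by (intro Suc.IH[where m = "Suc m"] filtration_act[OF raise C conj functional_on_pairing[OF \<Psi>]]) simp_all
    finally show ?case .
  qed
  have "x [^]\<^bsub>bidual_ring G\<^esub> Suc (card C) = (\<lambda>_. 0)"
  proof (rule pairing_eqI[OF pow ell1_bidual_zero])
    fix f :: "'a \<Rightarrow> complex" assume f: "bounded_fun (carrier G) f"
    \<comment> \<open>Level 0 imposes no invariance and contains every bounded function.\<close>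
    then have "f \<in> filtration C 0"
      by (intro filtration.base[of "{}"]) (simp_all add: right_invariant_def)
    then show "pairing G (x [^]\<^bsub>bidual_ring G\<^esub> Suc (card C)) f = pairing G (\<lambda>_. 0) f"
      using *[of f 0 "Suc (card C)"] by (simp add: pairing_def)
  qed
  then show ?thesis
    by (simp add: x_def)
qed

text \<open>On the family \<open>lam\<close>, \<open>\<Phi>\<close> behaves like the sum of all
  partial derivatives on a squarefree monomial: it deletes one factor in every possible way. Each
  order of deleting all of S contributes \<open>lam {} \<one>\<close>.\<close>

lemma pairing_power_factorial:
  assumes \<Phi>: "\<Phi> \<in> ell1_bidual G" and "finite S" "S \<subseteq> J"
    and bounded: "\<And>S. S \<subseteq> J \<Longrightarrow> bounded_fun (carrier G) (lam S)"
    and step: "\<And>S s. S \<subseteq> J \<Longrightarrow> s \<in> carrier G \<Longrightarrow>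
      pairing G \<Phi> (\<lambda>t. lam S (s \<otimes> t)) = (\<Sum>j\<in>S. lam (S - {j}) s)"
    and empty: "lam {} \<one> = 1"
  shows "pairing G (\<Phi> [^]\<^bsub>bidual_ring G\<^esub> card S) (lam S) = fact (card S)"
proof -
  interpret R: ring "bidual_ring G" by (rule ring_bidual_ring)
  have pow: "\<Phi> [^]\<^bsub>bidual_ring G\<^esub> (n::nat) \<in> ell1_bidual G" for n
    using R.nat_pow_closed[of \<Phi> n] \<Phi> by (simp add: bidual_ring_simps)
  have "pairing G (\<Phi> [^]\<^bsub>bidual_ring G\<^esub> n) (lam S) = fact n"
    if "finite S" "card S = n" "S \<subseteq> J" for n S
    using that
  proof (induction n arbitrary: S)
    case 0
    then show ?case
      using bounded[of "{}"] by (simp add: bidual_ring_simps pairing_delta empty)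
  next
    case (Suc n)
    have "pairing G (\<Phi> [^]\<^bsub>bidual_ring G\<^esub> Suc n) (lam S)
        = pairing G (\<Phi> [^]\<^bsub>bidual_ring G\<^esub> n) (\<lambda>s. pairing G \<Phi> (\<lambda>t. lam S (s \<otimes> t)))"
      using pairing_arens[OF \<Phi> bounded[OF Suc.prems(3)]] by (simp add: bidual_ring_simps)
    also have "\<dots> = pairing G (\<Phi> [^]\<^bsub>bidual_ring G\<^esub> n) (\<lambda>s. \<Sum>j\<in>S. lam (S - {j}) s)"
      by (rule functional_on_cong[OF functional_on_pairing[OF pow]]) (rule step[OF Suc.prems(3)])
    also have "\<dots> = (\<Sum>j\<in>S. pairing G (\<Phi> [^]\<^bsub>bidual_ring G\<^esub> n) (lam (S - {j})))"
      using Suc.prems(3) by (intro functional_on_sum[OF functional_on_pairing[OF pow]] bounded) blast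
    also have "\<dots> = (\<Sum>j\<in>S. fact n)"
      using Suc.prems by (intro sum.cong refl Suc.IH) auto
    also have "\<dots> = fact (Suc n)"
      using Suc.prems(2) by simp
    finally show ?case .
  qed
  then show ?thesis
    using assms(2,3) by blast
qed

section \<open>Internal direct products\<close>

text \<open>The coordinate x in h = c x, where c lies in the subgroup C generated by the other
  factors and x in \<open>F j\<close>. C is normal in H and meets \<open>F j\<close> trivially. For
  t in another factor, h t = c (x t x^-1) x, and x t x^-1 is again in C, so x does not
  change.\<close>

lemma internal_direct_product_projection:
  assumes H: "subgroup H G" and prod: "internal_direct_product G H k F" and j: "j < k"
  shows "\<exists>p. (\<forall>h\<in>H. p h \<in> F j) \<and> (\<forall>h\<in>H. \<forall>t\<in>F j. p (h \<otimes> t) = p h \<otimes> t)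
    \<and> (\<forall>h\<in>H. \<forall>l<k. l \<noteq> j \<longrightarrow> (\<forall>t\<in>F l. p (h \<otimes> t) = p h))"
proof -
  interpret H: subgroup H G by (rule H)
  let ?K = "G\<lparr>carrier := H\<rparr>"
  interpret K: group ?K by (rule H.subgroup_is_group[OF group_axioms])
  have normal: "F l \<lhd> ?K" if "l < k" for l
    using prod that by (simp add: internal_direct_product_def)
  have FH: "F l \<subseteq> H" if "l < k" for l
    using normal_imp_subgroup[OF normal[OF that]] subgroup.subset by force
  define C where "C = generate G (\<Union>l\<in>{..<k} - {j}. F l)"
  have UH: "(\<Union>l\<in>{..<k} - {j}. F l) \<subseteq> H" "(\<Union>l<k. F l) \<subseteq> H"
    using FH by blast+
  have C_eq: "C = generate ?K (\<Union>l\<in>{..<k} - {j}. F l)"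
    unfolding C_def by (rule generate_consistent[OF UH(1) H, symmetric])
  have C_normal: "C \<lhd> ?K"
    unfolding C_eq
  proof (rule K.normal_generateI)
    show "(\<Union>l\<in>{..<k} - {j}. F l) \<subseteq> carrier ?K"
      using UH by simp
    fix h g assume h: "h \<in> (\<Union>l\<in>{..<k} - {j}. F l)" and g: "g \<in> carrier ?K"
    then obtain l where "l < k" "l \<noteq> j" "h \<in> F l" by blast
    then show "g \<otimes>\<^bsub>?K\<^esub> h \<otimes>\<^bsub>?K\<^esub> inv\<^bsub>?K\<^esub> g \<in> (\<Union>l\<in>{..<k} - {j}. F l)"
      using normal.inv_op_closed2[OF normal g] by blast
  qed
  have subF: "subgroup (F j) ?K"
    by (rule normal_imp_subgroup[OF normal[OF j]])
  have subC: "subgroup C ?K"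
    by (rule normal_imp_subgroup[OF C_normal])
  have sub: "subgroup (C <#>\<^bsub>?K\<^esub> F j) ?K"
    by (rule K.mult_norm_subgroup[OF C_normal subF])
  have "F l \<subseteq> C <#>\<^bsub>?K\<^esub> F j" if l: "l < k" for l
  proof
    fix x assume x: "x \<in> F l"
    show "x \<in> C <#>\<^bsub>?K\<^esub> F j"
    proof (cases "l = j")
      case True
      have "x = \<one> \<otimes> x"
        using x FH[OF l] by auto
      then show ?thesis
        using x True subgroup.one_closed[OF subC] unfolding set_mult_def by auto
    next
      case False
      then have "x \<in> C"
        unfolding C_def using x l by (intro generate.incl) blast
      moreover have "x = x \<otimes> \<one>"
        using x FH[OF l] by auto
      ultimately show ?thesis
        using subgroup.one_closed[OF subF] unfolding set_mult_def by auto
    qed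
  qed
  then have "generate ?K (\<Union>l<k. F l) \<subseteq> C <#>\<^bsub>?K\<^esub> F j"
    by (intro K.generate_subgroup_incl[OF _ sub]) blast
  moreover have "generate ?K (\<Union>l<k. F l) = H"
    using prod generate_consistent[OF UH(2) H] by (simp add: internal_direct_product_def)
  ultimately have decomp: "\<exists>c\<in>C. \<exists>x\<in>F j. h = c \<otimes> x" if "h \<in> H" for h
    using that unfolding set_mult_def by fastforce
  have CH: "C \<subseteq> H"
    using subgroup.subset[OF subC] by simp
  have trivial: "C \<inter> F j = {\<one>}"
    using prod j unfolding internal_direct_product_def C_def by blast
  have carr: "x \<in> carrier G" if "x \<in> H" for x
    using that by simp
  have unique: "x = x'" if "c \<in> C" "x \<in> F j" "c' \<in> C" "x' \<in> F j" "c \<otimes> x = c' \<otimes> x'" for c x c' x'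
  proof -
    have mem: "c \<in> carrier G" "x \<in> carrier G" "c' \<in> carrier G" "x' \<in> carrier G"
      using that FH[OF j] CH carr by blast+
    have "x \<otimes> inv x' = inv c \<otimes> (c \<otimes> x) \<otimes> inv x'"
      using mem by (simp add: m_assoc[symmetric])
    also have "\<dots> = inv c \<otimes> c'"
      unfolding that(5) using mem by (simp add: m_assoc)
    finally have eq: "x \<otimes> inv x' = inv c \<otimes> c'" .
    have "subgroup C G" "subgroup (F j) G"
      using incl_subgroup[OF H subC] incl_subgroup[OF H subF] by auto
    then have "x \<otimes> inv x' \<in> F j" "inv c \<otimes> c' \<in> C"
      using that by (simp_all add: subgroup.m_closed subgroup.m_inv_closed)
    then have "x \<otimes> inv x' = \<one>"
      using trivial eq by (metis IntI singletonD)
    then show ?thesis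
      using mem by (metis inv_equality inv_inv inv_closed)
  qed
  define p where "p h = (SOME x. x \<in> F j \<and> (\<exists>c\<in>C. h = c \<otimes> x))" for h
  have p_eq: "p (c \<otimes> x) = x" if "c \<in> C" "x \<in> F j" for c x
    unfolding p_def by (rule some_equality) (use that unique in blast)+
  have p1: "p h \<in> F j" if "h \<in> H" for h
    using decomp[OF that] p_eq by auto
  have p2: "p (h \<otimes> t) = p h \<otimes> t" if h: "h \<in> H" and t: "t \<in> F j" for h t
  proof -
    obtain c x where cx: "c \<in> C" "x \<in> F j" "h = c \<otimes> x"
      using decomp[OF h] by blast
    have "h \<otimes> t = c \<otimes> (x \<otimes> t)"
      using cx t FH[OF j] CH carr by (simp add: m_assoc subset_eq)
    moreover have "x \<otimes> t \<in> F j"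
      using subgroup.m_closed[OF subF cx(2) t] by simp
    ultimately show ?thesis
      using cx p_eq by simp
  qed
  have p3: "p (h \<otimes> t) = p h" if h: "h \<in> H" and l: "l < k" "l \<noteq> j" and t: "t \<in> F l" for h l t
  proof -
    obtain c x where cx: "c \<in> C" "x \<in> F j" "h = c \<otimes> x"
      using decomp[OF h] by blast
    have xH: "x \<in> H" and mem: "c \<in> carrier G" "x \<in> carrier G" "t \<in> carrier G"
      using cx t FH[OF j] FH[OF l(1)] CH carr by blast+
    have "t \<in> C"
      unfolding C_def using t l by (intro generate.incl) blast
    then have "x \<otimes> t \<otimes> inv x \<in> C"
      using normal.inv_op_closed2[OF C_normal, of x t] xH m_inv_consistent[OF H xH] by simp
    then have "c \<otimes> (x \<otimes> t \<otimes> inv x) \<in> C"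
      using subgroup.m_closed[OF subC cx(1)] by simp
    moreover have "h \<otimes> t = c \<otimes> (x \<otimes> t \<otimes> inv x) \<otimes> x"
      using mem by (simp add: cx(3) m_assoc)
    ultimately show ?thesis
      using cx p_eq by simp
  qed
  show ?thesis
    by (intro exI[of _ p] conjI ballI allI impI) (simp_all add: p1 p2 p3)
qed

text \<open>Used in contrapositive form: an infinite product has an infinite factor. By normality of
  the last factor, its product set with the group generated by the others is a subgroup, so it
  contains all that is generated and is finite.\<close>

lemma finite_generate_normals:
  assumes "\<And>l. l < k \<Longrightarrow> F l \<lhd> G" "\<And>l. l < (k::nat) \<Longrightarrow> finite (F l)"
  shows "finite (generate G (\<Union>l<k. F l))"
  using assms
proof (induction k)
  case 0
  show ?case
    by (simp add: generate_empty)
next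
  case (Suc k)
  let ?C = "generate G (\<Union>l<k. F l)"
  have "F l \<subseteq> carrier G" if "l < Suc k" for l
    by (rule subgroup.subset[OF normal_imp_subgroup[OF Suc.prems(1)[OF that]]])
  then have "(\<Union>l<k. F l) \<subseteq> carrier G"
    by (meson UN_least lessThan_iff less_SucI)
  then have sub: "subgroup ?C G" "F k \<lhd> G"
    using Suc.prems(1)[of k] by (simp_all add: generate_is_subgroup)
  have sF: "subgroup (F k) G"
    by (rule normal_imp_subgroup[OF sub(2)])
  have "F l \<subseteq> F k <#> ?C" if "l < Suc k" for l
  proof
    fix x assume x: "x \<in> F l"
    then have xc: "x \<in> carrier G"
      using subgroup.subset[OF normal_imp_subgroup[OF Suc.prems(1)[OF that]]] by blast
    show "x \<in> F k <#> ?C"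
    proof (cases "l = k")
      case True
      have "x = x \<otimes> \<one>" using xc by simp
      then show ?thesis
        using x True subgroup.one_closed[OF sub(1)] unfolding set_mult_def by blast
    next
      case False
      have "x \<in> ?C"
        using x that False by (intro generate.incl) auto
      moreover have "x = \<one> \<otimes> x" using xc by simp
      ultimately show ?thesis
        using subgroup.one_closed[OF sF] unfolding set_mult_def by blast
    qed
  qed
  then have "generate G (\<Union>l<Suc k. F l) \<subseteq> F k <#> ?C"
    by (intro generate_subgroup_incl mult_norm_subgroup sub) blast
  moreover have "finite (F k <#> ?C)"
    using Suc by (auto simp: set_mult_def)
  ultimately show ?case
    by (rule finite_subset)
qed

lemma infinite_finite_index_subgroup:
  assumes "subgroup H G" "finite (rcosets H)" "infinite (carrier G)"
  shows "infinite H"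
proof
  assume "finite H"
  then have "finite A" if "A \<in> rcosets H" for A
    using that unfolding RCOSETS_def r_coset_def by auto
  then have "finite (\<Union>(rcosets H))"
    using assms(2) by blast
  then show False
    using rcosets_part_G[OF assms(1)] assms(3) by simp
qed

section \<open>Nilpotent elements from direct products\<close>

lemma bounded_fun_prod:
  assumes "\<And>i. i \<in> I \<Longrightarrow> bounded_fun S (f i)"
  shows "bounded_fun S (\<lambda>x. \<Prod>i\<in>I. f i x)"
  using assms by (induction I rule: infinite_finite_induct) (auto intro: bounded_fun_mult)

text \<open>The contribution of a single level: k infinite factors permuted by conjugation. The same
  element serves both spans and the radical.\<close>

lemma direct_product_nilpotent:
  assumes amen: "amenable G" and H: "H \<lhd> G" and prod: "internal_direct_product G H k F"
    and inf: "\<And>j. j < k \<Longrightarrow> infinite (F j)"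
    and perm: "\<And>g j. g \<in> carrier G \<Longrightarrow> j < k \<Longrightarrow> \<exists>l<k. conjugate_set g (F j) = F l"
  shows "\<exists>\<Phi>. \<Phi> \<in> A_sn G \<and> \<Phi> \<in> J_sn G \<and> \<Phi> \<in> jacobson_radical (bidual_ring G)
    \<and> nilpotent_elem (bidual_ring G) \<Phi> \<and> k < nilpotency_index (bidual_ring G) \<Phi>"
proof -
  interpret R: ring "bidual_ring G" by (rule ring_bidual_ring)
  interpret H: normal H G by (rule H)
  have Hsub: "subgroup H G"
    by (rule normal_imp_subgroup[OF H])
  let ?K = "G\<lparr>carrier := H\<rparr>"
  have normal: "F j \<lhd> ?K" if "j < k" for j
    using prod that by (simp add: internal_direct_product_def)
  have sub: "subgroup (F j) G" if "j < k" for j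
    by (rule incl_subgroup[OF Hsub normal_imp_subgroup[OF normal[OF that]]])
  have FH: "F j \<subseteq> H" if "j < k" for j
    using normal_imp_subgroup[OF normal[OF that]] subgroup.subset by force
  have subnormal: "subnormal (F j) G" if j: "j < k" for j
    unfolding subnormal_def
  proof (intro exI conjI allI impI)
    let ?S = "\<lambda>i::nat. if i = 0 then carrier G else if i = 1 then H else F j"
    show "?S 0 = carrier G" "?S 2 = F j"
      by simp_all
    show "?S (Suc i) \<lhd> G\<lparr>carrier := ?S i\<rparr>" if "i < 2" for i
      using that H normal[OF j] by (cases i) auto
  qed
  have "\<forall>j\<in>{..<k}. \<exists>\<gamma> a. invariant_diff (F j) \<gamma> \<and> bounded_fun (F j) a \<and> \<gamma> a = 1"
    using exists_invariant_diff[OF amen sub inf] by simp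
  then obtain \<gamma> a where \<gamma>a: "\<forall>j\<in>{..<k}. invariant_diff (F j) (\<gamma> j) \<and> bounded_fun (F j) (a j) \<and> \<gamma> j (a j) = 1"
    unfolding bchoice_iff by blast
  have \<gamma>: "invariant_diff (F j) (\<gamma> j)" and a: "bounded_fun (F j) (a j)" and \<gamma>1: "\<gamma> j (a j) = 1"
    if "j < k" for j
    using \<gamma>a that by auto
  have f\<gamma>: "functional_on (F j) (\<gamma> j)" if "j < k" for j
    using \<gamma>[OF that] by (simp add: invariant_diff_def)
  have f\<gamma>G: "functional_on (carrier G) (\<gamma> j)" if "j < k" for j
    using functional_on_mono[OF f\<gamma>[OF that] subgroup.subset[OF sub[OF that]]] .
  define \<Gamma> where "\<Gamma> j = of_functional G (\<gamma> j)" for j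
  have \<Gamma>: "\<Gamma> j \<in> sn_differences G" "\<Gamma> j \<in> ell1_bidual G" if "j < k" for j
    unfolding \<Gamma>_def using that
    by (auto intro!: of_functional_invariant_diff of_functional_bidual sub subnormal \<gamma> f\<gamma>G)
  define \<Phi> where "\<Phi> = (\<Sum>j<k. \<Gamma> j)"
  have \<Phi>: "\<Phi> \<in> ell1_bidual G"
    unfolding \<Phi>_def using \<Gamma> by (intro sum_bidual) simp
  have pairing\<Phi>: "pairing G \<Phi> f = (\<Sum>j<k. \<gamma> j f)" if f: "bounded_fun (carrier G) f" for f
    unfolding \<Phi>_def pairing_sum
    by (intro sum.cong refl) (simp add: \<Gamma>_def pairing_of_functional f\<gamma>G f)
  have \<Phi>A: "\<Phi> \<in> A_sn G"
    unfolding \<Phi>_def using \<Gamma> by (intro sum_sn_differences_in_A_sn) simp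
  have \<Phi>J: "\<Phi> \<in> J_sn G"
    unfolding \<Phi>_def using \<Gamma> by (intro sum_sn_differences_in_J_sn) simp
  define C where "C = F ` {..<k}"
  have C: "finite C" "\<And>K. K \<in> C \<Longrightarrow> K \<subseteq> carrier G"
    using sub subgroup.subset by (auto simp: C_def)
  have conj: "conjugate_set g K \<in> C" if "g \<in> carrier G" "K \<in> C" for g K
    using perm[OF that(1)] that(2) by (auto simp: C_def)
  have normalises: "inv t \<otimes> l \<otimes> t \<in> K'" if j: "j < k" and t: "t \<in> F j" and K': "K' \<in> C" and l: "l \<in> K'" for t K' l j
  proof -
    obtain i where i: "i < k" "K' = F i"
      using K' by (auto simp: C_def)
    have tH: "t \<in> H"
      using t FH[OF j] by blast
    show ?thesis
      using normal.inv_op_closed1[OF normal[OF i(1)], of t l] tH l i(2) m_inv_consistent[OF Hsub tH]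
      by simp
  qed
  have raise: "(\<lambda>s. pairing G \<Phi> (\<lambda>t. f (s \<otimes> t))) \<in> filtration C (Suc m)"
    if f: "f \<in> filtration C m" for f m
  proof -
    have "(\<lambda>s. \<gamma> j (\<lambda>t. f (s \<otimes> t))) \<in> filtration C (Suc m)" if "j \<in> {..<k}" for j
    proof -
      have j: "j < k" "F j \<in> C"
        using that by (auto simp: C_def)
      show ?thesis
        by (rule filtration_raise[OF f C j(2) sub[OF j(1)] normalises[OF j(1)] \<gamma>[OF j(1)]])
    qed
    then have "(\<lambda>s. \<Sum>j<k. \<gamma> j (\<lambda>t. f (s \<otimes> t))) \<in> filtration C (Suc m)"
      by (rule filtration_sum)
    then show ?thesis
      using filtration_bounded[OF f]
      by (elim filtration.agree) (simp add: pairing\<Phi> bounded_fun_translate)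
  qed
  have nil: "arens G \<Psi> \<Phi> [^]\<^bsub>bidual_ring G\<^esub> Suc (card C) = (\<lambda>_. 0)" if "\<Psi> \<in> ell1_bidual G" for \<Psi>
    by (rule filtration_nilpotent[OF C conj \<Phi> that raise])
  have \<Phi>rad: "\<Phi> \<in> jacobson_radical (bidual_ring G)"
  proof (rule R.jacobson_radicalI)
    show "\<Phi> \<in> carrier (bidual_ring G)"
      using \<Phi> by (simp add: bidual_ring_simps)
    fix \<Psi> assume "\<Psi> \<in> carrier (bidual_ring G)"
    then show "\<exists>n::nat. (\<Psi> \<otimes>\<^bsub>bidual_ring G\<^esub> \<Phi>) [^]\<^bsub>bidual_ring G\<^esub> n = \<zero>\<^bsub>bidual_ring G\<^esub>"
      using nil[of \<Psi>] by (intro exI[of _ "Suc (card C)"]) (simp only: bidual_ring_simps)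
  qed
  \<comment> \<open>The unit as left multiplier turns \<open>nil\<close> into nilpotency of
    \<open>\<Phi>\<close> itself.\<close>
  have "arens G (delta G \<one>) \<Phi> = \<Phi>"
    using R.l_one[of \<Phi>] \<Phi> by (simp add: bidual_ring_simps)
  then have "\<Phi> [^]\<^bsub>bidual_ring G\<^esub> Suc (card C) = \<zero>\<^bsub>bidual_ring G\<^esub>"
    using nil[OF delta_bidual[OF one_closed]] by (simp only: bidual_ring_simps)
  then have ex: "\<exists>n::nat. n > 0 \<and> \<Phi> [^]\<^bsub>bidual_ring G\<^esub> n = \<zero>\<^bsub>bidual_ring G\<^esub>"
    by blast
  have "\<forall>j\<in>{..<k}. \<exists>p. (\<forall>h\<in>H. p h \<in> F j) \<and> (\<forall>h\<in>H. \<forall>t\<in>F j. p (h \<otimes> t) = p h \<otimes> t)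
      \<and> (\<forall>h\<in>H. \<forall>l<k. l \<noteq> j \<longrightarrow> (\<forall>t\<in>F l. p (h \<otimes> t) = p h))"
    using internal_direct_product_projection[OF Hsub prod] by simp
  then obtain p where p: "\<forall>j\<in>{..<k}. (\<forall>h\<in>H. p j h \<in> F j) \<and> (\<forall>h\<in>H. \<forall>t\<in>F j. p j (h \<otimes> t) = p j h \<otimes> t)
      \<and> (\<forall>h\<in>H. \<forall>l<k. l \<noteq> j \<longrightarrow> (\<forall>t\<in>F l. p j (h \<otimes> t) = p j h))"
    unfolding bchoice_iff by blast
  \<comment> \<open>The product of the test functions \<open>a j\<close> over j in S, pulled back
    along the coordinates of H and extended by 0 off H.\<close>
  define lam where "lam S s = (if s \<in> H then \<Prod>j\<in>S. a j (p j s) else 0)" for S s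
  have lam_bounded: "bounded_fun (carrier G) (lam S)" if "S \<subseteq> {..<k}" for S
  proof -
    have "bounded_fun H (\<lambda>s. a j (p j s))" if "j \<in> S" for j
    proof -
      have j: "j < k"
        using that \<open>S \<subseteq> {..<k}\<close> by blast
      show ?thesis
        by (rule bounded_fun_compose[where h = "p j", OF a[OF j]]) (use p j in simp)
    qed
    then have "bounded_fun H (\<lambda>s. \<Prod>j\<in>S. a j (p j s))"
      by (rule bounded_fun_prod)
    then obtain K where "0 \<le> K" "\<forall>s\<in>H. cmod (\<Prod>j\<in>S. a j (p j s)) \<le> K"
      using bounded_funD by blast
    then show ?thesis
      by (intro bounded_funI[of _ _ K]) (simp add: lam_def)
  qed
  \<comment> \<open>Along \<open>F j\<close> only the j-th coordinate moves. If j is in S, the other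
    factors come out as a constant, left invariance removes \<open>p j s\<close>, and
    \<open>\<gamma> j (a j) = 1\<close> remains. If not, the function is constant on
    \<open>F j\<close> and is annihilated. Off H both sides vanish, since \<open>F j\<close> lies in
    H.\<close>
  have step1: "\<gamma> j (\<lambda>t. lam S (s \<otimes> t)) = (if j \<in> S then lam (S - {j}) s else 0)"
    if j: "j < k" and S: "S \<subseteq> {..<k}" and s: "s \<in> carrier G" for j S s
  proof (cases "s \<in> H")
    case False
    have "s \<otimes> t \<notin> H" if "t \<in> F j" for t
    proof
      assume "s \<otimes> t \<in> H"
      moreover have t: "t \<in> H"
        using that FH[OF j] by blast
      ultimately have "s \<otimes> t \<otimes> inv t \<in> H"
        by simp
      then show False
        using False s t by (simp add: m_assoc)
    qed
    then have "\<gamma> j (\<lambda>t. lam S (s \<otimes> t)) = \<gamma> j (\<lambda>_. 0)"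
      by (intro functional_on_cong[OF f\<gamma>[OF j]]) (simp add: lam_def)
    then show ?thesis
      using False functional_on_zero[OF f\<gamma>[OF j]] by (simp add: lam_def)
  next
    case True
    have fin: "finite S"
      using S finite_subset by blast
    have stH: "s \<otimes> t \<in> H" if "t \<in> F j" for t
      using True that FH[OF j] by blast
    have pj: "p j (s \<otimes> t) = p j s \<otimes> t" if "t \<in> F j" for t
      using p j True that by simp
    have pi: "p i (s \<otimes> t) = p i s" if "t \<in> F j" "i \<in> S" "i \<noteq> j" for t i
      using p j True that S by (metis lessThan_iff subsetD)
    have other: "(\<Prod>i\<in>S - {j}. a i (p i (s \<otimes> t))) = (\<Prod>i\<in>S - {j}. a i (p i s))" if "t \<in> F j" for t
      using that by (intro prod.cong) (simp_all add: pi)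
    let ?c = "\<Prod>i\<in>S - {j}. a i (p i s)"
    show ?thesis
    proof (cases "j \<in> S")
      case jS: True
      have b: "bounded_fun (F j) (\<lambda>t. a j (p j s \<otimes> t))"
        using p j True subgroup.m_closed[OF sub[OF j]] by (intro bounded_fun_compose[OF a[OF j]]) simp
      have "\<gamma> j (\<lambda>t. lam S (s \<otimes> t)) = \<gamma> j (\<lambda>t. ?c * a j (p j s \<otimes> t))"
      proof (rule functional_on_cong[OF f\<gamma>[OF j]])
        fix t assume t: "t \<in> F j"
        have "lam S (s \<otimes> t) = a j (p j (s \<otimes> t)) * (\<Prod>i\<in>S - {j}. a i (p i (s \<otimes> t)))"
          unfolding lam_def using stH[OF t] prod.remove[OF fin jS] by simp
        then show "lam S (s \<otimes> t) = ?c * a j (p j s \<otimes> t)"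
          by (simp add: other[OF t] pj[OF t] mult.commute)
      qed
      also have "\<dots> = ?c * \<gamma> j (\<lambda>t. a j (p j s \<otimes> t))"
        by (rule functional_on_scale[OF f\<gamma>[OF j] b])
      also have "\<gamma> j (\<lambda>t. a j (p j s \<otimes> t)) = 1"
        using \<gamma>[OF j] a[OF j] \<gamma>1[OF j] p j True by (simp add: invariant_diff_def)
      finally show ?thesis
        using jS True by (simp add: lam_def)
    next
      case jS: False
      have "\<gamma> j (\<lambda>t. lam S (s \<otimes> t)) = \<gamma> j (\<lambda>_. ?c)"
        using stH other jS by (intro functional_on_cong[OF f\<gamma>[OF j]]) (simp add: lam_def)
      then show ?thesis
        using jS functional_on_const[OF f\<gamma>[OF j], of ?c] \<gamma>[OF j] by (simp add: invariant_diff_def)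
    qed
  qed
  have "pairing G (\<Phi> [^]\<^bsub>bidual_ring G\<^esub> card {..<k}) (lam {..<k}) = fact (card {..<k})"
  proof (rule pairing_power_factorial[OF \<Phi> _ subset_refl])
    fix S s assume S: "S \<subseteq> {..<k}" and s: "s \<in> carrier G"
    have "pairing G \<Phi> (\<lambda>t. lam S (s \<otimes> t)) = (\<Sum>j<k. if j \<in> S then lam (S - {j}) s else 0)"
      using s S by (simp add: pairing\<Phi> bounded_fun_translate lam_bounded step1)
    also have "\<dots> = (\<Sum>j\<in>S. lam (S - {j}) s)"
      using S by (simp add: sum.inter_restrict[symmetric] Int_absorb1)
    finally show "pairing G \<Phi> (\<lambda>t. lam S (s \<otimes> t)) = (\<Sum>j\<in>S. lam (S - {j}) s)" .
  next
    show "bounded_fun (carrier G) (lam S)" if "S \<subseteq> {..<k}" for S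
      by (rule lam_bounded[OF that])
    show "lam {} \<one> = 1"
      by (simp add: lam_def)
  qed simp
  then have neq: "\<Phi> [^]\<^bsub>bidual_ring G\<^esub> k \<noteq> \<zero>\<^bsub>bidual_ring G\<^esub>"
    by (auto simp: bidual_ring_simps pairing_def)
  have "k < nilpotency_index (bidual_ring G) \<Phi>"
  proof (rule ccontr)
    define n where "n = nilpotency_index (bidual_ring G) \<Phi>"
    assume "\<not> k < nilpotency_index (bidual_ring G) \<Phi>"
    then have "n \<le> k"
      by (simp add: n_def)
    have zero: "\<Phi> [^]\<^bsub>bidual_ring G\<^esub> n = \<zero>\<^bsub>bidual_ring G\<^esub>"
      using LeastI_ex[OF ex] by (simp add: n_def nilpotency_index_def)
    have \<Phi>c: "\<Phi> \<in> carrier (bidual_ring G)"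
      using \<Phi> by (simp add: bidual_ring_simps)
    \<comment> \<open>A vanishing power makes all later powers vanish, so a least exponent n at most
      k would contradict \<open>neq\<close>.\<close>
    have "\<Phi> [^]\<^bsub>bidual_ring G\<^esub> k
        = \<Phi> [^]\<^bsub>bidual_ring G\<^esub> n \<otimes>\<^bsub>bidual_ring G\<^esub> \<Phi> [^]\<^bsub>bidual_ring G\<^esub> (k - n)"
      using R.nat_pow_mult[OF \<Phi>c, of n "k - n"] \<open>n \<le> k\<close> by simp
    then show False
      using neq zero R.l_null[OF R.nat_pow_closed[OF \<Phi>c]] by simp
  qed
  moreover have "nilpotent_elem (bidual_ring G) \<Phi>"
    using ex \<Phi> by (simp add: nilpotent_elem_def bidual_ring_simps)
  ultimately show ?thesis
    using \<Phi>A \<Phi>J \<Phi>rad by blast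
qed

end

section \<open>Branch groups: a level with enough infinite factors\<close>

theorem proposition5p5:
  fixes G :: "('a, 'b) monoid_scheme"
  assumes "group G" and "branch_group G" and "amenable G"
  shows "(\<forall>N. \<exists>\<Phi>\<in>A_sn G. nilpotent_elem (bidual_ring G) \<Phi>
            \<and> N \<le> nilpotency_index (bidual_ring G) \<Phi>)
       \<and> (\<forall>N. \<exists>\<Phi>\<in>J_sn G. nilpotent_elem (bidual_ring G) \<Phi>
            \<and> N \<le> nilpotency_index (bidual_ring G) \<Phi>)
       \<and> (\<forall>N. \<exists>\<Phi>\<in>jacobson_radical (bidual_ring G). nilpotent_elem (bidual_ring G) \<Phi>
            \<and> N \<le> nilpotency_index (bidual_ring G) \<Phi>)"
proof -
  interpret group G by (rule assms(1))
  obtain H L F k where inf: "infinite (carrier G)"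
    and k0: "\<forall>i. 0 < k i"
    and H: "\<forall>i. H i \<lhd> G \<and> finite (rcosets\<^bsub>G\<^esub> (H i))"
    and F: "\<forall>i. internal_direct_product G (H i) (k i) (F i)
             \<and> (\<forall>j<k i. (G\<lparr>carrier := F i j\<rparr>) \<cong> (G\<lparr>carrier := L i\<rparr>))"
    and k_step: "\<forall>i. k i dvd k (Suc i) \<and> 2 \<le> k (Suc i) div k i
             \<and> (let m = k (Suc i) div k i in
                  \<forall>j<k i. \<forall>l\<in>{j * m..<(j + 1) * m}. F (Suc i) l \<subseteq> F i j)"
    and conj: "\<forall>i. (\<forall>g\<in>carrier G. \<forall>j<k i. \<exists>l<k i.
                 (\<lambda>h. g \<otimes>\<^bsub>G\<^esub> h \<otimes>\<^bsub>G\<^esub> inv\<^bsub>G\<^esub> g) ` F i j = F i l)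
             \<and> (\<forall>j<k i. \<forall>l<k i. \<exists>g\<in>carrier G.
                 (\<lambda>h. g \<otimes>\<^bsub>G\<^esub> h \<otimes>\<^bsub>G\<^esub> inv\<^bsub>G\<^esub> g) ` F i j = F i l)"
    using assms(2) unfolding branch_group_def by - (elim conjE exE, rule that)
  have k_dvd: "k i dvd k (Suc i)" for i
    by (rule conjunct1[OF spec[OF k_step]])
  have k_ge: "2 \<le> k (Suc i) div k i" for i
    by (rule conjunct1[OF conjunct2[OF spec[OF k_step]]])
  have perm: "\<exists>l<k i. (\<lambda>h. g \<otimes>\<^bsub>G\<^esub> h \<otimes>\<^bsub>G\<^esub> inv\<^bsub>G\<^esub> g) ` F i j = F i l"
    if "g \<in> carrier G" "j < k i" for g i j
    by (rule bspec[OF conjunct1[OF spec[OF conj]] that(1), rule_format, OF that(2)])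
  have "\<exists>\<Phi>. \<Phi> \<in> A_sn G \<and> \<Phi> \<in> J_sn G \<and> \<Phi> \<in> jacobson_radical (bidual_ring G)
    \<and> nilpotent_elem (bidual_ring G) \<Phi> \<and> N \<le> nilpotency_index (bidual_ring G) \<Phi>" for N
  proof -
    \<comment> \<open>The number of factors at least doubles from level to level, so level N has
      more than N of them.\<close>
    have grow: "i < k i" for i
    proof (induction i)
      case (Suc i)
      have "k (Suc i) = k i * (k (Suc i) div k i)"
        using k_dvd by simp
      also have "\<dots> \<ge> k i * 2"
        using k_ge by (rule mult_le_mono2)
      finally show ?case
        using Suc by simp
    qed (use k0 in simp)
    have Hsub: "subgroup (H N) G"
      using H by (simp add: normal_imp_subgroup)
    \<comment> \<open>The factors are normal in \<open>H N\<close> but possibly not in G, so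
      \<open>finite_generate_normals\<close> is applied with \<open>H N\<close> as ambient
      group.\<close>
    interpret K: group "G\<lparr>carrier := H N\<rparr>"
      by (rule subgroup.subgroup_is_group[OF Hsub group_axioms])
    have prod: "internal_direct_product G (H N) (k N) (F N)"
      using F by simp
    have normal: "F N j \<lhd> G\<lparr>carrier := H N\<rparr>" if "j < k N" for j
      using prod that by (simp add: internal_direct_product_def)
    have "F N j \<subseteq> H N" if "j < k N" for j
      using normal_imp_subgroup[OF normal[OF that]] subgroup.subset by force
    then have "(\<Union>j<k N. F N j) \<subseteq> H N"
      by (intro UN_least) simp
    then have "generate (G\<lparr>carrier := H N\<rparr>) (\<Union>j<k N. F N j) = H N"
      using prod generate_consistent[OF _ Hsub, of "\<Union>j<k N. F N j"]
      by (simp add: internal_direct_product_def)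
    moreover have "infinite (H N)"
      by (rule infinite_finite_index_subgroup[OF Hsub conjunct2[OF spec[OF H]] inf])
    ultimately obtain j0 where j0: "j0 < k N" "infinite (F N j0)"
      using K.finite_generate_normals[of "k N" "F N"] normal by auto
    \<comment> \<open>All factors of the level are isomorphic to \<open>L N\<close> and hence
      equipotent, so one infinite factor makes all of them infinite.\<close>
    have bij: "\<exists>f. bij_betw f (F N j) (L N)" if "j < k N" for j
      using F that by (auto simp: is_iso_def iso_def)
    have infF: "infinite (F N j)" if "j < k N" for j
      using bij[OF that] bij[OF j0(1)] j0(2) bij_betw_finite by metis
    have "\<exists>l<k N. conjugate_set g (F N j) = F N l" if "g \<in> carrier G" "j < k N" for g j
      using perm that by (simp add: conjugate_set_def)
    then obtain \<Phi> where "\<Phi> \<in> A_sn G" "\<Phi> \<in> J_sn G" "\<Phi> \<in> jacobson_radical (bidual_ring G)"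
      "nilpotent_elem (bidual_ring G) \<Phi>" "k N < nilpotency_index (bidual_ring G) \<Phi>"
      using direct_product_nilpotent[OF assms(3) _ prod infF] H by blast
    then show ?thesis
      using grow[of N] by (intro exI[of _ \<Phi>]) simp
  qed
  then show ?thesis
    by blast
qed

end
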